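(* (Stokes phenomenon.) Let $q\in\mathbf{C}$, $|q|>1$. Let $\mu_1<\cdots<\mu_k$ be integers, $A_i\in\mathrm{GL}_{r_i}(\mathbf{C})$, $A_0=\mathrm{diag}(z^{\mu_1}A_1,\dots,z^{\mu_k}A_k)$, and let $\mathcal{C}_{A_0}$ be the set of block upper triangular matrices $A$ with diagonal blocks $z^{\mu_i}A_i$ and blocks $U_{i,j}\in\mathrm{Mat}_{r_i,r_j}(K_{\mu_i,\mu_j})$ for $i<j$. Let $\{A_0\}\subset\mathbf{C}^*$ be the set of $\lambda$ generic for $A_0$. Fix some $\lambda_0\in\{A_0\}$ and, for any $\lambda\in\{A_0\}$ and $A\in\mathcal{C}_{A_0}$, set $$\mathrm{St}_{\lambda_0}(\lambda;A):=\bigl(F^A_{[\lambda_0;q:A_0]}\bigr)^{-1}F^A_{[\lambda;q:A_0]}.$$ The following conditions are equivalent: (1) there exists $\lambda\in\{A_0\}$ such that $[\lambda;q]\ne[\lambda_0;q]$ but $\mathrm{St}_{\lambda_0}(\lambda;A)=\mathrm{Id}$; (2) for all $\lambda\in\{A_0\}$, the equality $\mathrm{St}_{\lambda_0}(\lambda;A)=\mathrm{Id}$ holds; (3) $A=A_0$.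
   Context: $\sigma_qf(z)=f(qz)$; $[\lambda]=[\lambda;q]=\lambda q^{\mathbf{Z}}$. For integers $\mu<\nu$, $K_{\mu,\nu}:=\sum_{\ell=0}^{\nu-\mu-1}\mathbf{C}z^\ell$ or, at will, $K_{\mu,\nu}:=\sum_{\ell=\mu}^{\nu-1}\mathbf{C}z^\ell$. A divisor is a finite formal sum $\Lambda=\sum_i\nu_i[\lambda_i]$ ($\nu_i\in\mathbf{N}^*$, distinct $[\lambda_i]$), with $|\Lambda|=\sum\nu_i$ and $\|\Lambda\|=(-1)^{|\Lambda|}\prod\lambda_i^{\nu_i}$ modulo $q^{\mathbf{Z}}$. An ordered family of divisors $(\Lambda_1,\dots,\Lambda_{k-1})$ is generic for $A_0$ if $|\Lambda_i|=\mu_{i+1}-\mu_i$ for $1\le i\le k-1$ and $\|\Lambda_i\|\not\equiv\alpha_i/\alpha_j\pmod{q^{\mathbf{Z}}}$ for any eigenvalues $\alpha_i$ of $A_i$ and $\alpha_j$ of $A_j$, $j>i$. For $\lambda\in\mathbf{C}^*$, $[\lambda;q:A_0]$ denotes the ordered family $(\Lambda_1,\dots,\Lambda_{k-1})$ with $\Lambda_i=(\mu_{i+1}-\mu_i)[\lambda]$; $\lambda$ is generic for $A_0$ if this family is, that is, if $(-\lambda)^{\mu_{i+1}-\mu_i}\not\equiv\alpha_i/\alpha_j\pmod{q^{\mathbf{Z}}}$ for all $1\le i<j\le k$ and all such eigenvalues. For $\lambda$ generic and $A\in\mathcal{C}_{A_0}$, $F^A_{[\lambda;q:A_0]}=(F_{i,j})$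 is the unique block upper triangular matrix with diagonal blocks $I_{r_i}$ (entries germs of functions at $0$) such that $(\sigma_qF)A_0=AF$ and, for $i<j$, the entries of $F_{i,j}$ belong to $\mathbb{O}^{\Lambda_{i,j}}_{(\Lambda_i,\dots,\Lambda_{j-1})}$, where $\Lambda_{i,j}=\Lambda_i+\cdots+\Lambda_{j-1}=(\mu_j-\mu_i)[\lambda]$. Definition of $\mathbb{O}$ for divisors supported by $[\lambda]$: $d(z)=\inf_{\xi\in[\lambda]}|1-z/\xi|$; $\theta(z)=\sum_{n\in\mathbf{Z}}q^{-n(n-1)/2}z^n$; $e(z)=\sum_{n\in\mathbf{Z}}|q|^{-n(n-1)/2}|z|^n$. For positive integers $d_1,\dots,d_m$ with sum $D$, put $D_{i}=\sum_{j\ge i}d_j$ ($D_{m+1}=0$). $\mathbb{O}^{D[\lambda]}_{(d_1[\lambda],\dots,d_m[\lambda])}$ is the set of germs $f$ of functions analytic in $\{0<|z|<R\}\setminus[\lambda]$ for some $R>0$, bounded on $\{0<|z|<r,\ d(z)>\epsilon\}$ for all $\epsilon>0$ and $0<r<R$, such that $F(z)=\theta(-z/\lambda)^{D}f(z)$ is analytic in a punctured neighborhood of $0$, satisfies $|F(z)|\le C\,e(\mu z)^{D}$ near $0$ for some $C,\mu>0$ and, for each $i=1,\dots,m$ and each $D_{i+1}\le j<D_i$, satisfies $|F^{(j)}(\lambda q^{-n})|\le CB^n|q|^{D_{i+1}n^2/2}$ for some $C,B>0$ and all large $n$. *)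

theory Defs
  imports
    "HOL-Analysis.Analysis"
    "Jordan_Normal_Form.Gauss_Jordan_Elimination"
    "Jordan_Normal_Form.Char_Poly"
begin

definition qspiral :: "complex \<Rightarrow> complex \<Rightarrow> complex set" where
  "qspiral q x = {x * q powi n | n :: int. True}"

definition qdist :: "complex \<Rightarrow> complex \<Rightarrow> complex \<Rightarrow> real" where
  "qdist q lam z = (INF xi \<in> qspiral q lam. cmod (1 - z / xi))"

definition qtheta :: "complex \<Rightarrow> complex \<Rightarrow> complex" where
  "qtheta q z = (\<Sum>\<^sub>\<infinity>n\<in>(UNIV :: int set). q powi (- (n * (n - 1) div 2)) * z powi n)"

definition qe :: "complex \<Rightarrow> complex \<Rightarrow> real" where
  "qe q z = (\<Sum>\<^sub>\<infinity>n\<in>(UNIV :: int set). cmod q powi (- (n * (n - 1) div 2)) * cmod z powi n)"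

text \<open>
  The list \<open>ds\<close> is \<open>[d\<^sub>1, \<dots>, d\<^sub>m]\<close>, so that \<open>sum_list (drop i ds)\<close> is \<open>D\<^sub>i\<^sub>+\<^sub>1\<close>, the sum of the
  \<open>d\<^sub>j\<close> with \<open>j \<ge> i + 1\<close>. A germ is represented by any function having the required behaviour
  near \<open>0\<close> off the spiral; its values on the spiral are irrelevant. The function \<open>G\<close> is the
  analytic extension of \<open>\<theta>(-z/\<lambda>)^D f(z)\<close> across the points of the spiral.
\<close>
definition germs_O :: "complex \<Rightarrow> complex \<Rightarrow> nat list \<Rightarrow> (complex \<Rightarrow> complex) set" where
  "germs_O q lam ds = {f. \<exists>R > 0.
     f holomorphic_on ({z. 0 < cmod z \<and> cmod z < R} - qspiral q lam) \<and>
     (\<forall>\<epsilon> > 0. \<forall>r. 0 < r \<and> r < R \<longrightarrow>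
        bounded (f ` {z. 0 < cmod z \<and> cmod z < r \<and> qdist q lam z > \<epsilon>})) \<and>
     (\<exists>G. \<exists>\<rho> > 0. \<rho> \<le> R \<and>
        G holomorphic_on {z. 0 < cmod z \<and> cmod z < \<rho>} \<and>
        (\<forall>z. 0 < cmod z \<and> cmod z < \<rho> \<and> z \<notin> qspiral q lam \<longrightarrow>
           G z = qtheta q (- z / lam) ^ sum_list ds * f z) \<and>
        (\<exists>C > 0. \<exists>c > 0. \<forall>\<^sub>F z in at 0.
           cmod (G z) \<le> C * qe q (complex_of_real c * z) ^ sum_list ds) \<and>
        (\<forall>i < length ds. \<forall>j. sum_list (drop (Suc i) ds) \<le> j \<and> j < sum_list (drop i ds) \<longrightarrow>
           (\<exists>C > 0. \<exists>B > 0. \<forall>\<^sub>F n :: nat in sequentially.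
              cmod ((deriv ^^ j) G (lam * q powi (- int n)))
                \<le> C * B ^ n * cmod q powr (real (sum_list (drop (Suc i) ds)) * (real n)\<^sup>2 / 2))))}"

text \<open>Blocks are numbered from \<open>1\<close>; the \<open>i\<close>-th block starts at row (column) \<open>block_offset r i\<close>.\<close>

definition block_offset :: "(nat \<Rightarrow> nat) \<Rightarrow> nat \<Rightarrow> nat" where
  "block_offset r i = (\<Sum>l\<in>{1..<i}. r l)"

definition total_size :: "nat \<Rightarrow> (nat \<Rightarrow> nat) \<Rightarrow> nat" where
  "total_size k r = (\<Sum>l\<in>{1..k}. r l)"

definition block :: "(nat \<Rightarrow> nat) \<Rightarrow> nat \<Rightarrow> nat \<Rightarrow> complex mat \<Rightarrow> complex mat" where
  "block r i j M = Matrix.mat (r i) (r j)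
     (\<lambda>(a, b). M $$ (block_offset r i + a, block_offset r j + b))"

definition diag_system :: "nat \<Rightarrow> (nat \<Rightarrow> int) \<Rightarrow> (nat \<Rightarrow> complex mat) \<Rightarrow> complex \<Rightarrow> complex mat" where
  "diag_system k mu Ad z = diag_block_mat (map (\<lambda>i. (z powi mu i) \<cdot>\<^sub>m Ad i) [1..<Suc k])"

definition laurent_K :: "int \<Rightarrow> int \<Rightarrow> (complex \<Rightarrow> complex) set" where
  "laurent_K m n = {f. \<exists>c :: int \<Rightarrow> complex. \<forall>z. z \<noteq> 0 \<longrightarrow> f z = (\<Sum>l\<in>{m..n - 1}. c l * z powi l)}"

text \<open>Systems are functions on the punctured plane; their value at \<open>0\<close> is never used.\<close>
definition normal_forms ::
  "nat \<Rightarrow> (nat \<Rightarrow> nat) \<Rightarrow> (nat \<Rightarrow> int) \<Rightarrow> (nat \<Rightarrow> complex mat) \<Rightarrow> (complex \<Rightarrow> complex mat) set" where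
  "normal_forms k r mu Ad = {A.
     (\<forall>z. z \<noteq> 0 \<longrightarrow> A z \<in> carrier_mat (total_size k r) (total_size k r) \<and>
        (\<forall>i\<in>{1..k}. block r i i (A z) = (z powi mu i) \<cdot>\<^sub>m Ad i) \<and>
        (\<forall>i\<in>{1..k}. \<forall>j\<in>{1..k}. j < i \<longrightarrow> block r i j (A z) = 0\<^sub>m (r i) (r j))) \<and>
     (\<forall>i\<in>{1..k}. \<forall>j\<in>{1..k}. i < j \<longrightarrow> (\<forall>a < r i. \<forall>b < r j.
        (\<lambda>z. block r i j (A z) $$ (a, b)) \<in> laurent_K (mu i) (mu j)))}"

definition generic_set ::
  "complex \<Rightarrow> nat \<Rightarrow> (nat \<Rightarrow> int) \<Rightarrow> (nat \<Rightarrow> complex mat) \<Rightarrow> complex set" where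
  "generic_set q k mu Ad = {lam. lam \<noteq> 0 \<and>
     (\<forall>i j \<alpha> \<beta>. 1 \<le> i \<and> i < j \<and> j \<le> k \<and> eigenvalue (Ad i) \<alpha> \<and> eigenvalue (Ad j) \<beta> \<longrightarrow>
        (- lam) powi (mu (Suc i) - mu i) \<notin> qspiral q (\<alpha> / \<beta>))}"

definition slope_gaps :: "(nat \<Rightarrow> int) \<Rightarrow> nat \<Rightarrow> nat \<Rightarrow> nat list" where
  "slope_gaps mu i j = map (\<lambda>l. nat (mu (Suc l) - mu l)) [i..<j]"

text \<open>
  \<open>is_summation \<dots> A lam F\<close> says that \<open>F\<close> represents the germ \<open>F\<^sup>A\<close> attached to the spiral of \<open>lam\<close>.
  Identities between germs hold near \<open>0\<close>, off the spiral.
\<close>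
definition is_summation ::
  "complex \<Rightarrow> nat \<Rightarrow> (nat \<Rightarrow> nat) \<Rightarrow> (nat \<Rightarrow> int) \<Rightarrow> (nat \<Rightarrow> complex mat) \<Rightarrow>
   (complex \<Rightarrow> complex mat) \<Rightarrow> complex \<Rightarrow> (complex \<Rightarrow> complex mat) \<Rightarrow> bool" where
  "is_summation q k r mu Ad A lam F \<longleftrightarrow>
     (\<forall>\<^sub>F z in at 0 within - qspiral q lam.
        F z \<in> carrier_mat (total_size k r) (total_size k r) \<and>
        (\<forall>i\<in>{1..k}. block r i i (F z) = 1\<^sub>m (r i)) \<and>
        (\<forall>i\<in>{1..k}. \<forall>j\<in>{1..k}. j < i \<longrightarrow> block r i j (F z) = 0\<^sub>m (r i) (r j)) \<and>
        F (q * z) * diag_system k mu Ad z = A z * F z) \<and>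
     (\<forall>i\<in>{1..k}. \<forall>j\<in>{1..k}. i < j \<longrightarrow> (\<forall>a < r i. \<forall>b < r j.
        (\<lambda>z. block r i j (F z) $$ (a, b)) \<in> germs_O q lam (slope_gaps mu i j)))"

text \<open>
  The graph of the partial map sending \<open>lam\<close> to the germ \<open>(F\<^sup>A\<^sub>0)\<inverse> F\<^sup>A\<close> (with \<open>F\<^sup>A\<^sub>0\<close> attached to
  \<open>lam0\<close>): \<open>St\<close> is defined at \<open>lam\<close> and equal to \<open>S\<close>. The relational form does not presuppose that
  the summations exist or are unique, and no arbitrary value is involved. The inverse is a genuine
  one, since \<open>F0 z\<close> is block unipotent.
\<close>
definition is_stokes ::
  "complex \<Rightarrow> nat \<Rightarrow> (nat \<Rightarrow> nat) \<Rightarrow> (nat \<Rightarrow> int) \<Rightarrow> (nat \<Rightarrow> complex mat) \<Rightarrow> complex \<Rightarrow>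
   complex \<Rightarrow> (complex \<Rightarrow> complex mat) \<Rightarrow> (complex \<Rightarrow> complex mat) \<Rightarrow> bool" where
  "is_stokes q k r mu Ad lam0 lam A S \<longleftrightarrow>
     (\<exists>F0 F. is_summation q k r mu Ad A lam0 F0 \<and> is_summation q k r mu Ad A lam F \<and>
        (\<forall>\<^sub>F z in at 0 within - (qspiral q lam0 \<union> qspiral q lam).
           S z = the (mat_inverse (F0 z)) * F z))"

end

theory Submission
  imports Defs "HOL-Complex_Analysis.Complex_Analysis"
begin

text \<open>
  If the Stokes matrix is trivial for two distinct spirals, the two summations glue to a matrix that is
  holomorphic in a punctured disc. The spirals are disjoint and \<open>q\<close>-invariant, so every \<open>z\<close> is
  uniformly away from one of them, and the gluing is bounded and extends to \<open>0\<close>: the formal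
  gauge transformation from \<open>A\<^sub>0\<close> to \<open>A\<close> converges. Going up block by block, an off-diagonal block then satisfies
  \<open>z\<^sup>d F(qz) A\<^sub>j = A\<^sub>i F(z) + V(z)\<close> with a polynomial \<open>V\<close> of degree \<open>< d\<close>, hence
  \<open>q\<^sup>n F\<^sub>n = A\<^sub>i F\<^sub>n\<^sub>+\<^sub>d A\<^sub>j\<inverse>\<close>. Unless \<open>F = 0\<close>, the coefficients grow like a Gaussian power of \<open>q\<close>,
  contradicting convergence; so \<open>F = 0\<close> and \<open>V = 0\<close>.
\<close>

section \<open>Convergent solutions of q-difference equations\<close>

text \<open>Read as \<open>N m \<le> K * (1 / Q) ^ m * N (m + d)\<close>, the recursion gains a
  factor tending to 0. From some \<open>m0\<close> on it outweighs the factor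
  \<open>(1 / t) ^ d\<close> lost in the geometric bound, so each application halves that bound.
  Hence \<open>N\<close> vanishes from \<open>m0\<close> on, and the recursion carries the zeros
  back in steps of \<open>d\<close>.\<close>

lemma growth_recursion_zero:
  fixes N :: "nat \<Rightarrow> real" and K Q C t :: real
  assumes Q: "Q > 1" and d: "d > 0" and K: "K \<ge> 0" and t: "t > 0"
    and nonneg: "\<And>n. N n \<ge> 0"
    and bound: "\<And>n. N n \<le> C * (1 / t) ^ n"
    and rec: "\<And>n. Q ^ n * N n \<le> K * N (n + d)"
  shows "N n = 0"
proof -
  have "((\<lambda>m. K * (1 / t) ^ d * (1 / Q) ^ m) \<longlongrightarrow> K * (1 / t) ^ d * 0) sequentially"
    using Q by (intro tendsto_intros LIMSEQ_power_zero) auto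
  then have "\<forall>\<^sub>F m in sequentially. K * (1 / t) ^ d * (1 / Q) ^ m < 1 / 2"
    by (rule order_tendstoD) simp
  then obtain m0 where m0: "\<And>m. m \<ge> m0 \<Longrightarrow> K * (1 / t) ^ d * (1 / Q) ^ m < 1 / 2"
    by (auto simp: eventually_sequentially)
  have C: "C \<ge> 0" using bound[of 0] nonneg[of 0] by simp
  have step: "N m \<le> K * (1 / Q) ^ m * N (m + d)" for m
    using rec[of m] Q by (simp add: field_simps)
  have halving: "N m \<le> (1 / 2) ^ l * C * (1 / t) ^ m" if "m \<ge> m0" for m l
    using that
  proof (induction l arbitrary: m)
    case 0
    then show ?case using bound[of m] by simp
  next
    case (Suc l)
    have "N m \<le> K * (1 / Q) ^ m * N (m + d)" by (rule step)
    also have "\<dots> \<le> K * (1 / Q) ^ m * ((1 / 2) ^ l * C * (1 / t) ^ (m + d))"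
      using Suc Q K by (intro mult_left_mono) auto
    also have "\<dots> = (K * (1 / t) ^ d * (1 / Q) ^ m) * ((1 / 2) ^ l * C * (1 / t) ^ m)"
      by (simp add: power_add mult_ac)
    also have "\<dots> \<le> (1 / 2) * ((1 / 2) ^ l * C * (1 / t) ^ m)"
      using m0[OF Suc.prems] C t by (intro mult_right_mono) auto
    finally show ?case by simp
  qed
  have tail: "N m = 0" if "m \<ge> m0" for m
  proof -
    have "((\<lambda>l. (1 / 2) ^ l * C * (1 / t) ^ m) \<longlongrightarrow> 0 * C * (1 / t) ^ m) sequentially"
      by (intro tendsto_intros LIMSEQ_power_zero) auto
    then have "N m \<le> 0 * C * (1 / t) ^ m"
      using halving[OF that] by (intro LIMSEQ_le_const) auto
    then show ?thesis using nonneg[of m] by simp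
  qed
  have "N m = 0" if "N (m + l * d) = 0" for l m
    using that
  proof (induction l arbitrary: m)
    case (Suc l)
    have "N (m + d) = 0" by (rule Suc.IH) (use Suc.prems in \<open>simp add: algebra_simps\<close>)
    then show ?case using step[of m] nonneg[of m] by simp
  qed simp
  \<comment> \<open>As \<open>d > 0\<close>, going up \<open>m0\<close> steps of length
    \<open>d\<close> from any \<open>n\<close> reaches an index that is at least
    \<open>m0\<close>.\<close>
  moreover have "N (n + m0 * d) = 0"
    using d by (intro tail) (metis le_add2 mult.right_neutral mult_le_mono2 Suc_leI One_nat_def le_trans)
  ultimately show ?thesis by blast
qed

text \<open>The terms of a power series at a point inside its disc of convergence are bounded, which
  bounds the coefficients geometrically. All smaller radii \<open>s\<close> are allowed with the
  same \<open>C\<close>, so that finitely many series can share one radius.\<close>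

lemma has_fps_expansion_coeff_bound:
  fixes f :: "complex \<Rightarrow> complex"
  assumes "f has_fps_expansion \<phi>"
  obtains t C where "t > 0" "\<And>s n. 0 < s \<Longrightarrow> s \<le> t \<Longrightarrow> cmod (fps_nth \<phi> n) \<le> C * (1 / s) ^ n"
proof -
  have "fps_conv_radius \<phi> > 0" using assms by (simp add: has_fps_expansion_def)
  then obtain t where t: "0 < ereal t" "ereal t < fps_conv_radius \<phi>"
    using ereal_dense2 by blast
  have "summable (\<lambda>n. fps_nth \<phi> n * of_real t ^ n)"
    using t by (intro summable_fps) auto
  then have "Bseq (\<lambda>n. fps_nth \<phi> n * of_real t ^ n)"
    by (metis convergent_imp_Bseq convergentI summable_LIMSEQ_zero)
  then obtain C where C: "\<And>n. cmod (fps_nth \<phi> n * of_real t ^ n) \<le> C"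
    by (auto simp: Bseq_def)
  have "cmod (fps_nth \<phi> n) \<le> C * (1 / s) ^ n" if "0 < s" "s \<le> t" for s n
  proof -
    have "cmod (fps_nth \<phi> n) * s ^ n \<le> cmod (fps_nth \<phi> n) * t ^ n"
      using that by (intro mult_left_mono power_mono) auto
    also have "\<dots> \<le> C" using C[of n] t by (simp add: norm_mult norm_power)
    finally show ?thesis using that by (simp add: field_simps)
  qed
  with t that show ?thesis by auto
qed

text \<open>In degree \<open>n + d\<close> the polynomial is invisible, and comparing coefficients
  expresses q^n times the n-th coefficient vector as \<open>T\<close> applied to the (n+d)-th. The
  sum of the moduli of the components then satisfies the growth recursion with Q = |q|, while
  convergence bounds it geometrically.\<close>

lemma q_difference_system_trivial:
  fixes f :: "'i \<Rightarrow> complex \<Rightarrow> complex" and T :: "'i \<Rightarrow> 'i \<Rightarrow> complex"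
  assumes q: "cmod q > 1" and d: "d > 0" and I: "finite I"
    and fps: "\<And>i. i \<in> I \<Longrightarrow> f i has_fps_expansion \<phi> i"
    and deg: "\<And>i. i \<in> I \<Longrightarrow> degree (p i) < d"
    and eq: "\<And>i. i \<in> I \<Longrightarrow>
      \<forall>\<^sub>F z in at 0. z ^ d * f i (q * z) = (\<Sum>j\<in>I. T i j * f j z) + poly (p i) z"
    and i: "i \<in> I"
  shows "\<phi> i = 0"
proof -
  have coeff: "q ^ n * fps_nth (\<phi> i) n = (\<Sum>j\<in>I. T i j * fps_nth (\<phi> j) (n + d))" if i: "i \<in> I" for i n
  proof -
    have "(f i \<circ> (\<lambda>z. q * z)) has_fps_expansion (\<phi> i oo (fps_const q * fps_X))"
      by (intro has_fps_expansion_compose fps[OF i] fps_expansion_intros) auto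
    then have 1: "(\<lambda>z. z ^ d * f i (q * z)) has_fps_expansion
        (fps_X ^ d * (\<phi> i oo (fps_const q * fps_X)))"
      by (intro fps_expansion_intros) (simp_all add: o_def)
    have 2: "(\<lambda>z. (\<Sum>j\<in>I. T i j * f j z) + poly (p i) z) has_fps_expansion
        (\<Sum>j\<in>I. fps_const (T i j) * \<phi> j) + fps_of_poly (p i)"
      by (intro fps_expansion_intros fps) (auto simp: has_fps_expansion_def)
    \<comment> \<open>The equation is given on a punctured neighbourhood only. Both sides have
      expansions at 0, so they are continuous there and their difference vanishes at 0 too.\<close>
    have ev: "\<forall>\<^sub>F z in nhds 0. z ^ d * f i (q * z) = (\<Sum>j\<in>I. T i j * f j z) + poly (p i) z"
    proof -
      define g where "g z = z ^ d * f i (q * z) - ((\<Sum>j\<in>I. T i j * f j z) + poly (p i) z)" for z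
      have "\<forall>\<^sub>F z in at 0. g z = 0"
        using eq[OF i] by eventually_elim (simp add: g_def)
      then have "g \<midarrow>0\<rightarrow> 0" by (rule tendsto_eventually)
      moreover have "isCont g 0"
        using has_fps_expansion_imp_continuous[OF has_fps_expansion_diff[OF 1 2], of UNIV]
        by (simp add: g_def[abs_def])
      then have "g \<midarrow>0\<rightarrow> g 0" by (simp add: isCont_def)
      ultimately have "g 0 = 0" using tendsto_unique[OF trivial_limit_at] by blast
      with eq[OF i] show ?thesis by (simp add: eventually_nhds_conv_at g_def)
    qed
    have "(\<lambda>z. z ^ d * f i (q * z)) has_fps_expansion
        (\<Sum>j\<in>I. fps_const (T i j) * \<phi> j) + fps_of_poly (p i)"
      using 2 has_fps_expansion_cong[OF ev refl] by blast
    with 1 have "fps_X ^ d * (\<phi> i oo (fps_const q * fps_X)) =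
        (\<Sum>j\<in>I. fps_const (T i j) * \<phi> j) + fps_of_poly (p i)"
      by (rule fps_expansion_unique_complex)
    then have "fps_nth (fps_X ^ d * (\<phi> i oo (fps_const q * fps_X))) (n + d) =
        fps_nth ((\<Sum>j\<in>I. fps_const (T i j) * \<phi> j) + fps_of_poly (p i)) (n + d)" by simp
    then show ?thesis
      using deg[OF i] by (simp add: fps_X_power_mult_nth fps_compose_linear fps_sum_nth coeff_eq_0)
  qed
  have "\<forall>i\<in>I. \<exists>t C. t > 0 \<and> (\<forall>s n. 0 < s \<longrightarrow> s \<le> t \<longrightarrow> cmod (fps_nth (\<phi> i) n) \<le> C * (1 / s) ^ n)"
    using has_fps_expansion_coeff_bound[OF fps] by metis
  then obtain t C where t: "\<And>i. i \<in> I \<Longrightarrow> t i > 0"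
    and C: "\<And>i s n. i \<in> I \<Longrightarrow> 0 < s \<Longrightarrow> s \<le> t i \<Longrightarrow> cmod (fps_nth (\<phi> i) n) \<le> C i * (1 / s) ^ n"
    by metis
  \<comment> \<open>The least radius serves all components at once.\<close>
  define s where "s = Min (t ` I)"
  have "s \<in> t ` I" unfolding s_def using I i by (intro Min_in) auto
  then have s: "0 < s" "\<And>i. i \<in> I \<Longrightarrow> s \<le> t i" using I t by (auto simp: s_def)
  define N where "N n = (\<Sum>i\<in>I. cmod (fps_nth (\<phi> i) n))" for n
  define K where "K = (\<Sum>i\<in>I. \<Sum>j\<in>I. cmod (T i j))"
  have K: "cmod (T i j) \<le> (\<Sum>i\<in>I. cmod (T i j))" if "i \<in> I" for i j
    using that I by (intro member_le_sum) auto
  have "N n = 0" for n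
  proof (rule growth_recursion_zero[OF q d _ \<open>0 < s\<close>])
    show "0 \<le> K" by (simp add: K_def sum_nonneg)
    show "0 \<le> N n" for n by (simp add: N_def sum_nonneg)
    show "N n \<le> sum C I * (1 / s) ^ n" for n
      unfolding N_def sum_distrib_right by (intro sum_mono C s)
    show "cmod q ^ n * N n \<le> K * N (n + d)" for n
    proof -
      have "cmod q ^ n * N n = (\<Sum>i\<in>I. cmod (q ^ n * fps_nth (\<phi> i) n))"
        by (simp add: N_def sum_distrib_left norm_mult norm_power)
      also have "\<dots> \<le> (\<Sum>i\<in>I. \<Sum>j\<in>I. cmod (T i j) * cmod (fps_nth (\<phi> j) (n + d)))"
        by (intro sum_mono) (auto simp: coeff simp flip: norm_mult intro: norm_sum)
      also have "\<dots> \<le> (\<Sum>i\<in>I. \<Sum>j\<in>I. cmod (T i j) * N (n + d))"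
        using I by (intro sum_mono mult_left_mono) (auto simp: N_def intro!: member_le_sum)
      also have "\<dots> = K * N (n + d)"
        by (simp add: K_def sum_distrib_right)
      finally show ?thesis .
    qed
  qed
  then have "cmod (fps_nth (\<phi> i) n) = 0" for n
    using I i by (simp add: N_def sum_nonneg_eq_0_iff)
  then show ?thesis by (simp add: fps_eq_iff)
qed

lemma poly_eq_0_if_eventually:
  fixes p :: "complex poly"
  assumes "\<forall>\<^sub>F z in at 0. poly p z = 0"
  shows "p = 0"
proof (rule ccontr)
  assume "p \<noteq> 0"
  then have "finite {z. poly p z = 0}" by (rule poly_roots_finite)
  then have "\<forall>\<^sub>F z in at 0. poly p z \<noteq> 0"
    by (metis (mono_tags, lifting) eventually_mono islimpt_finite islimpt_iff_eventually mem_Collect_eq)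
  with assms have "\<forall>\<^sub>F z in at (0::complex). False" by eventually_elim simp
  then show False by simp
qed

text \<open>In matrix form the equation is z^d F(qz) N = M F(z) + P(z). Right multiplication by the
  inverse of \<open>N\<close> makes F(qz) explicit and gives a linear system for the entries of F,
  so F vanishes near 0; all that is left of the equation is P = 0.\<close>

lemma q_sylvester_system_trivial:
  fixes f :: "nat \<Rightarrow> nat \<Rightarrow> complex \<Rightarrow> complex"
  assumes q: "cmod q > 1" and d: "d > 0"
    and N: "N \<in> carrier_mat n n" "invertible_mat N"
    and fps: "\<And>a b. a < m \<Longrightarrow> b < n \<Longrightarrow> f a b has_fps_expansion \<phi> a b"
    and deg: "\<And>a b. a < m \<Longrightarrow> b < n \<Longrightarrow> degree (p a b) < d"
    and eq: "\<And>a b. a < m \<Longrightarrow> b < n \<Longrightarrow> \<forall>\<^sub>F z in at 0.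
      z ^ d * (\<Sum>c<n. f a c (q * z) * N $$ (c, b)) = (\<Sum>c<m. M $$ (a, c) * f c b z) + poly (p a b) z"
    and ab: "a < m" "b < n"
  shows "p a b = 0"
proof -
  obtain N' where N': "N * N' = 1\<^sub>m n" "N' \<in> carrier_mat n n"
    using N unfolding invertible_mat_def inverts_mat_def
    by (metis carrier_matD carrier_matI index_mult_mat(2,3) index_one_mat(2,3))
  have NN': "(\<Sum>e<n. N $$ (c, e) * N' $$ (e, b)) = (if c = b then 1 else 0)" if "c < n" "b < n" for c b
  proof -
    have "(N * N') $$ (c, b) = (\<Sum>e<n. N $$ (c, e) * N' $$ (e, b))"
      using N N'(2) that by (auto simp: scalar_prod_def lessThan_atLeast0 intro!: sum.cong)
    then show ?thesis using N' that by simp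
  qed
  let ?I = "{..<m} \<times> {..<n}"
  have "\<phi> a b = 0" if ab: "a < m" "b < n" for a b
  proof -
    have "case_prod \<phi> (a, b) = 0"
    \<comment> \<open>The unknowns are indexed by pairs. \<open>T\<close> is the Kronecker product
      of \<open>M\<close> with the transpose of \<open>N'\<close>, and the polynomial part is P N',
      still of degree below \<open>d\<close>.\<close>
    proof (rule q_difference_system_trivial[OF q d, where I = ?I and f = "case_prod f" and
        T = "\<lambda>(a, b) (c, e). M $$ (a, c) * N' $$ (e, b)" and p = "\<lambda>(a, b). \<Sum>e<n. Polynomial.smult (N' $$ (e, b)) (p a e)"])
      show "finite ?I" by simp
      show "case_prod f i has_fps_expansion case_prod \<phi> i" if "i \<in> ?I" for i
        using that fps by auto
      show "degree (case i of (a, b) \<Rightarrow> \<Sum>e<n. Polynomial.smult (N' $$ (e, b)) (p a e)) < d" if "i \<in> ?I" for i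
      proof -
        have "degree (\<Sum>e<n. Polynomial.smult (N' $$ (e, snd i)) (p (fst i) e)) < d"
          using that deg d by (intro degree_sum_less) (auto intro: le_less_trans[OF degree_smult_le])
        then show ?thesis by (simp add: case_prod_beta)
      qed
      show "(a, b) \<in> ?I" using ab by simp
      fix i assume "i \<in> ?I"
      then obtain a b where i: "i = (a, b)" and ab: "a < m" "b < n" by auto
      have "\<forall>\<^sub>F z in at 0. \<forall>e\<in>{..<n}. z ^ d * (\<Sum>c<n. f a c (q * z) * N $$ (c, e)) =
          (\<Sum>c<m. M $$ (a, c) * f c e z) + poly (p a e) z"
        using eq[OF ab(1)] by (intro eventually_ball_finite) auto
      then have "\<forall>\<^sub>F z in at 0. z ^ d * f a b (q * z) =
          (\<Sum>(c, e)\<in>?I. M $$ (a, c) * N' $$ (e, b) * f c e z) + poly (\<Sum>e<n. Polynomial.smult (N' $$ (e, b)) (p a e)) z"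
      proof eventually_elim
        case (elim z)
        have "f a b (q * z) = (\<Sum>c<n. if c = b then f a c (q * z) else 0)"
          using ab by simp
        also have "\<dots> = (\<Sum>c<n. f a c (q * z) * (\<Sum>e<n. N $$ (c, e) * N' $$ (e, b)))"
          using ab by (intro sum.cong) (auto simp: NN')
        also have "\<dots> = (\<Sum>e<n. N' $$ (e, b) * (\<Sum>c<n. f a c (q * z) * N $$ (c, e)))"
          unfolding sum_distrib_left by (subst sum.swap) (auto intro!: sum.cong simp: mult_ac)
        finally have "z ^ d * f a b (q * z) = (\<Sum>e<n. N' $$ (e, b) * (z ^ d * (\<Sum>c<n. f a c (q * z) * N $$ (c, e))))"
          by (simp add: sum_distrib_left mult_ac)
        also have "\<dots> = (\<Sum>e<n. N' $$ (e, b) * ((\<Sum>c<m. M $$ (a, c) * f c e z) + poly (p a e) z))"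
          using elim by (intro sum.cong) auto
        also have "\<dots> = (\<Sum>e<n. \<Sum>c<m. M $$ (a, c) * N' $$ (e, b) * f c e z) + (\<Sum>e<n. N' $$ (e, b) * poly (p a e) z)"
          by (simp add: distrib_left sum.distrib sum_distrib_left mult_ac)
        also have "(\<Sum>e<n. \<Sum>c<m. M $$ (a, c) * N' $$ (e, b) * f c e z) = (\<Sum>(c, e)\<in>?I. M $$ (a, c) * N' $$ (e, b) * f c e z)"
          by (subst sum.swap) (simp add: sum.cartesian_product)
        finally show ?case by (simp add: poly_sum)
      qed
      then show "\<forall>\<^sub>F z in at 0. z ^ d * case_prod f i (q * z) =
          (\<Sum>j\<in>?I. (case i of (a, b) \<Rightarrow> \<lambda>(c, e). M $$ (a, c) * N' $$ (e, b)) j * case_prod f j z) +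
          poly (case i of (a, b) \<Rightarrow> \<Sum>e<n. Polynomial.smult (N' $$ (e, b)) (p a e)) z"
        by (simp add: i case_prod_beta)
    qed
    then show ?thesis by simp
  qed
  then have ev0: "\<forall>\<^sub>F z in nhds 0. f a b z = 0" if "a < m" "b < n" for a b
    using fps[OF that] that by (simp add: has_fps_expansion_0_iff)
  have q0: "filterlim (\<lambda>z. q * z) (nhds 0) (at 0)" by (auto intro!: tendsto_eq_intros)
  have "\<forall>\<^sub>F z in at 0. \<forall>c\<in>{..<n}. f a c (q * z) = 0"
    using ev0[OF ab(1)] filterlim_iff[THEN iffD1, OF q0] by (intro eventually_ball_finite) auto
  moreover have "\<forall>\<^sub>F z in at 0. \<forall>c\<in>{..<m}. f c b z = 0"
    using ev0[OF _ ab(2)] by (intro eventually_ball_finite) (auto intro: eventually_nhds_x_imp_x simp: eventually_nhds_conv_at)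
  ultimately have "\<forall>\<^sub>F z in at 0. poly (p a b) z = 0"
    using eq[OF ab] by eventually_elim simp
  then show ?thesis by (rule poly_eq_0_if_eventually)
qed

section \<open>Gluing germs along two spirals\<close>

lemma qspiral_imp_nonzero:
  assumes "q \<noteq> 0" "x \<noteq> 0" "z \<in> qspiral q x"
  shows "z \<noteq> 0"
  using assms by (auto simp: qspiral_def)

lemma qspiral_eqI:
  assumes "q \<noteq> 0" "x \<in> qspiral q y"
  shows "qspiral q x = qspiral q y"
proof -
  obtain m where m: "x = y * q powi m" using assms(2) by (auto simp: qspiral_def)
  have "x * q powi n = y * q powi (m + n)" for n
    using assms(1) by (simp add: m power_int_add)
  moreover have "y * q powi n = x * q powi (n - m)" for n
    using assms(1) by (simp add: m power_int_diff)
  ultimately show ?thesis unfolding qspiral_def by blast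
qed

lemma qspiral_self: "x \<in> qspiral q x"
  unfolding qspiral_def by (rule CollectI, rule exI[of _ 0]) simp

lemma qspiral_disjoint:
  assumes "q \<noteq> 0" "qspiral q x \<noteq> qspiral q y"
  shows "qspiral q x \<inter> qspiral q y = {}"
  using assms qspiral_eqI by blast

text \<open>By this invariance z and qz avoid a spiral together, so both sides of the functional
  equation can be read from the same summation.\<close>

lemma mult_q_mem_qspiral_iff:
  assumes "q \<noteq> 0"
  shows "q * z \<in> qspiral q x \<longleftrightarrow> z \<in> qspiral q x"
proof -
  have "q * z = z * q powi 1" "z = (q * z) * q powi (-1)" using assms by auto
  then have "q * z \<in> qspiral q z" "z \<in> qspiral q (q * z)"
    unfolding qspiral_def by blast+
  then show ?thesis using qspiral_eqI[OF assms] by metis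
qed

text \<open>The moduli along a spiral form a geometric progression of ratio |q| > 1, so only
  finitely many exponents keep the point inside an annulus.\<close>

lemma finite_qspiral_annulus:
  assumes q: "cmod q > 1" and x: "x \<noteq> 0" and a: "a > 0"
  shows "finite {z \<in> qspiral q x. a \<le> cmod z \<and> cmod z \<le> b}"
proof -
  \<comment> \<open>Exponents from \<open>M\<close> on push the modulus beyond \<open>b\<close>, and
    those up to \<open>-M\<close> push it below \<open>a\<close>.\<close>
  obtain M where M: "max (b / cmod x) (cmod x / a) < cmod q ^ M"
    using real_arch_pow[OF q] by blast
  have "n \<in> {- int M..int M}" if "a \<le> cmod x * cmod q powi n" "cmod x * cmod q powi n \<le> b" for n
  proof (rule ccontr)
    assume "n \<notin> {- int M..int M}"
    then consider "int M \<le> n" | "n \<le> - int M" by fastforce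
    then show False
    proof cases
      case 1
      then have "cmod q powi int M \<le> cmod q powi n" using q by (intro power_int_increasing) auto
      then have "b / cmod x < cmod q powi n" using M by simp
      then show False using that x by (simp add: field_simps)
    next
      case 2
      then have "cmod q powi n \<le> cmod q powi (- int M)" using q by (intro power_int_increasing) auto
      also have "\<dots> = 1 / cmod q ^ M" by (simp add: power_int_minus divide_inverse)
      also have "\<dots> < a / cmod x" using M q x a by (simp add: divide_less_eq less_divide_eq mult_ac)
      finally show False using that x by (simp add: field_simps)
    qed
  qed
  then have "{z \<in> qspiral q x. a \<le> cmod z \<and> cmod z \<le> b} \<subseteq> (\<lambda>n. x * q powi n) ` {- int M..int M}"
    by (auto simp: qspiral_def norm_mult norm_power_int)
  then show ?thesis by (rule finite_subset) simp
qed

text \<open>Spiral points accumulate only at 0, which \<open>S\<close> omits. Around any other point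
  a small annulus contains finitely many of them, and removing a finite set preserves
  openness.\<close>

lemma open_minus_qspiral:
  assumes q: "cmod q > 1" and x: "x \<noteq> 0" and S: "open S" "0 \<notin> S"
  shows "open (S - qspiral q x)"
  unfolding open_subopen[of "S - qspiral q x"]
proof
  fix z assume z: "z \<in> S - qspiral q x"
  then have "z \<noteq> 0" using S by auto
  define P where "P = {w \<in> qspiral q x. cmod z / 2 \<le> cmod w \<and> cmod w \<le> 2 * cmod z}"
  have "finite P" unfolding P_def using \<open>z \<noteq> 0\<close> by (intro finite_qspiral_annulus q x) auto
  then have "open ((S \<inter> {w. cmod z / 2 < cmod w} \<inter> {w. cmod w < 2 * cmod z}) - P)"
    by (intro open_Diff open_Int S open_Collect_less continuous_intros finite_imp_closed)
  moreover have "z \<in> (S \<inter> {w. cmod z / 2 < cmod w} \<inter> {w. cmod w < 2 * cmod z}) - P"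
    using z \<open>z \<noteq> 0\<close> by (auto simp: P_def)
  moreover have "(S \<inter> {w. cmod z / 2 < cmod w} \<inter> {w. cmod w < 2 * cmod z}) - P \<subseteq> S - qspiral q x"
    by (auto simp: P_def)
  ultimately show "\<exists>T. open T \<and> z \<in> T \<and> T \<subseteq> S - qspiral q x" by blast
qed

lemma bdd_below_qdist: "bdd_below ((\<lambda>\<xi>. cmod (1 - z / \<xi>)) ` S)"
  by (intro bdd_belowI[of _ 0]) auto

lemma qdist_pos_imp_not_mem:
  assumes "q \<noteq> 0" "x \<noteq> 0" "qdist q x z > 0"
  shows "z \<notin> qspiral q x"
proof
  assume z: "z \<in> qspiral q x"
  then have "qdist q x z \<le> cmod (1 - z / z)"
    unfolding qdist_def by (intro cINF_lower bdd_below_qdist)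
  then show False using assms qspiral_imp_nonzero[OF _ _ z] by simp
qed

lemma qdist_lessE:
  assumes "qdist q x z < \<delta>"
  obtains \<xi> where "\<xi> \<in> qspiral q x" "cmod (1 - z / \<xi>) < \<delta>"
  using assms qspiral_self[of x q] bdd_below_qdist[of z "qspiral q x"]
  unfolding qdist_def by (subst (asm) cINF_less_iff) auto

text \<open>If z were relatively close to a point \<xi> of the first spiral and to a point \<eta> of
  the second, then \<xi>/\<eta> would be close to 1. These ratios run through the spiral of x/y,
  which stays away from 1. Since \<open>qdist\<close> measures relative distance,
  \<open>\<delta>\<close> does not depend on z, even as z tends to 0.\<close>

lemma qspiral_separated:
  assumes q: "cmod q > 1" and xy: "x \<noteq> 0" "y \<noteq> 0" "x \<notin> qspiral q y"
  obtains \<delta> where "\<delta> > 0" "\<And>z. qdist q x z > \<delta> \<or> qdist q y z > \<delta>"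
proof -
  \<comment> \<open>Only ratios of modulus between 1/2 and 2 can come within 1/2 of 1, and they are
    finitely many.\<close>
  define P where "P = {\<xi> \<in> qspiral q (x / y). 1 / 2 \<le> cmod \<xi> \<and> cmod \<xi> \<le> 2}"
  have "finite P" unfolding P_def using xy by (intro finite_qspiral_annulus q) auto
  then obtain d where d: "d > 0" "\<And>\<xi>. \<xi> \<in> P \<Longrightarrow> \<xi> \<noteq> 1 \<Longrightarrow> d \<le> dist 1 \<xi>"
    using finite_set_avoid[of P 1] by blast
  have q0: "q \<noteq> 0" using q by auto
  have "\<xi> \<noteq> 1" if \<xi>: "\<xi> \<in> qspiral q (x / y)" for \<xi>
  proof
    assume "\<xi> = 1"
    then obtain n where "1 = x / y * q powi n" using \<xi> unfolding qspiral_def by blast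
    then have "x = y * q powi (-n)" using xy q0 by (simp add: power_int_minus field_simps)
    then show False using xy(3) by (auto simp: qspiral_def)
  qed
  then have away: "min d (1 / 2) \<le> cmod (1 - \<xi>)" if \<xi>: "\<xi> \<in> qspiral q (x / y)" for \<xi>
  proof (cases "\<xi> \<in> P")
    case True
    then show ?thesis using d(2)[of \<xi>] \<open>\<And>\<xi>. \<xi> \<in> qspiral q (x / y) \<Longrightarrow> \<xi> \<noteq> 1\<close> \<xi>
      by (simp add: dist_norm)
  next
    case False
    then have "cmod \<xi> < 1 / 2 \<or> cmod \<xi> > 2" using \<xi> by (auto simp: P_def)
    then have "1 / 2 \<le> cmod (1 - \<xi>)"
      using norm_triangle_ineq2[of 1 \<xi>] norm_triangle_ineq2[of \<xi> 1] by (auto simp: norm_minus_commute)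
    then show ?thesis by simp
  qed
  \<comment> \<open>With \<open>16 * \<delta>\<close> as the distance of the ratios from 1, two
    relative distances below \<open>2 * \<delta>\<close> give a numerator below
    \<open>4 * \<delta>\<close> over a denominator of modulus at least 1/2, that is, a quotient
    below \<open>8 * \<delta>\<close>. The bound \<open>\<delta> \<le> 1 / 32\<close> secures that
    denominator.\<close>
  define \<delta> where "\<delta> = min d (1 / 2) / 16"
  have \<delta>: "\<delta> > 0" "\<delta> \<le> 1 / 32" using d by (auto simp: \<delta>_def)
  have "qdist q x z > \<delta> \<or> qdist q y z > \<delta>" for z
  proof (rule ccontr)
    assume "\<not> (qdist q x z > \<delta> \<or> qdist q y z > \<delta>)"
    \<comment> \<open>The infimum in \<open>qdist\<close> need not be known to be attained; a strict
      bound yields an actual spiral point.\<close>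
    then have "qdist q x z < 2 * \<delta>" "qdist q y z < 2 * \<delta>" using \<delta> by auto
    then obtain \<xi> \<eta> where \<xi>: "\<xi> \<in> qspiral q x" "cmod (1 - z / \<xi>) < 2 * \<delta>"
      and \<eta>: "\<eta> \<in> qspiral q y" "cmod (1 - z / \<eta>) < 2 * \<delta>"
      by (metis qdist_lessE)
    have nz: "\<xi> \<noteq> 0" "\<eta> \<noteq> 0"
      by (rule qspiral_imp_nonzero[OF q0 xy(1) \<xi>(1)], rule qspiral_imp_nonzero[OF q0 xy(2) \<eta>(1)])
    have "z \<noteq> 0" using \<xi>(2) \<delta> by (intro notI) simp
    note nz = nz this
    obtain m n where "\<xi> = x * q powi m" "\<eta> = y * q powi n"
      using \<xi> \<eta> by (auto simp: qspiral_def)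
    then have "\<xi> / \<eta> = x / y * q powi (m - n)"
      using q0 by (simp add: power_int_diff)
    then have "min d (1 / 2) \<le> cmod (1 - \<xi> / \<eta>)" by (intro away) (auto simp: qspiral_def)
    also have "1 - \<xi> / \<eta> = ((1 - z / \<eta>) - (1 - z / \<xi>)) / (z / \<xi>)"
      using nz by (simp add: field_simps)
    finally have le: "16 * \<delta> \<le> cmod ((1 - z / \<eta>) - (1 - z / \<xi>)) / cmod (z / \<xi>)"
      by (simp only: \<delta>_def norm_divide[of "(1 - z / \<eta>) - (1 - z / \<xi>)"])
    have ge: "cmod (z / \<xi>) \<ge> 1 / 2"
      using norm_triangle_ineq2[of 1 "1 - z / \<xi>"] \<xi>(2) \<delta> by simp
    then have "16 * \<delta> * cmod (z / \<xi>) \<le> cmod ((1 - z / \<eta>) - (1 - z / \<xi>))"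
      using le by (subst (asm) pos_le_divide_eq) auto
    also have "\<dots> < 4 * \<delta>"
      using norm_triangle_ineq4[of "1 - z / \<eta>" "1 - z / \<xi>"] \<xi>(2) \<eta>(2) by linarith
    finally have "16 * \<delta> * cmod (z / \<xi>) < 4 * \<delta>" .
    moreover have "16 * \<delta> * cmod (z / \<xi>) \<ge> 16 * \<delta> * (1 / 2)"
      using \<delta> ge by (intro mult_left_mono) auto
    ultimately show False using \<delta> by simp
  qed
  with \<delta>(1) that show ?thesis by blast
qed

section \<open>Removing the singularities of two germs that agree\<close>

lemma germs_O_bounded_off_spiral:
  assumes "f \<in> germs_O q x ds"
  shows "\<exists>R > 0. f holomorphic_on ({z. 0 < cmod z \<and> cmod z < R} - qspiral q x) \<and>
     (\<forall>\<epsilon> > 0. \<forall>r. 0 < r \<and> r < R \<longrightarrow> bounded (f ` {z. 0 < cmod z \<and> cmod z < r \<and> qdist q x z > \<epsilon>}))"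
proof -
  have weaken: "\<exists>R. P R \<and> Q R \<and> S R" if "\<exists>R. P R \<and> Q R \<and> S R \<and> T R" for P Q S T :: "real \<Rightarrow> bool"
    using that by blast
  show ?thesis by (rule weaken[OF assms[unfolded germs_O_def mem_Collect_eq]])
qed

text \<open>Each germ is holomorphic across the spiral of the other, and the spirals are disjoint,
  so together the two domains cover a punctured disc. Uniform separation merges the two partial
  bounds into one, and Riemann's theorem removes the singularity at 0. Each germ equals
  \<open>h\<close> off its own spiral, hence also on the other spiral.\<close>

lemma germs_O_glue:
  assumes q: "cmod q > 1" and xy: "x \<noteq> 0" "y \<noteq> 0" "qspiral q x \<noteq> qspiral q y"
    and f: "f \<in> germs_O q x ds" and g: "g \<in> germs_O q y es"
    and eq: "\<forall>\<^sub>F z in at 0 within - (qspiral q x \<union> qspiral q y). f z = g z"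
  obtains h where "h analytic_on {0}"
    "\<forall>\<^sub>F z in at 0. (z \<notin> qspiral q x \<longrightarrow> f z = h z) \<and> (z \<notin> qspiral q y \<longrightarrow> g z = h z)"
proof -
  have q0: "q \<noteq> 0" using q by auto
  have disj: "qspiral q x \<inter> qspiral q y = {}" using qspiral_disjoint[OF q0 xy(3)] .
  obtain R1 where R1: "R1 > 0" "f holomorphic_on ({z. 0 < cmod z \<and> cmod z < R1} - qspiral q x)"
    and bf: "\<And>\<epsilon> r. \<epsilon> > 0 \<Longrightarrow> 0 < r \<Longrightarrow> r < R1 \<Longrightarrow> bounded (f ` {z. 0 < cmod z \<and> cmod z < r \<and> qdist q x z > \<epsilon>})"
    using germs_O_bounded_off_spiral[OF f] by blast
  obtain R2 where R2: "R2 > 0" "g holomorphic_on ({z. 0 < cmod z \<and> cmod z < R2} - qspiral q y)"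
    and bg: "\<And>\<epsilon> r. \<epsilon> > 0 \<Longrightarrow> 0 < r \<Longrightarrow> r < R2 \<Longrightarrow> bounded (g ` {z. 0 < cmod z \<and> cmod z < r \<and> qdist q y z > \<epsilon>})"
    using germs_O_bounded_off_spiral[OF g] by blast
  obtain d where d: "d > 0" "\<And>z. z \<notin> qspiral q x \<Longrightarrow> z \<notin> qspiral q y \<Longrightarrow> 0 < cmod z \<Longrightarrow> cmod z < d \<Longrightarrow> f z = g z"
    using eq unfolding eventually_at by auto
  define \<rho> where "\<rho> = min d (min R1 R2) / 2"
  have \<rho>: "\<rho> > 0" "\<rho> < d" "\<rho> < R1" "\<rho> < R2" using d R1 R2 by (auto simp: \<rho>_def)
  define D where "D = ball 0 \<rho> - {0::complex}"
  have D: "open D" "0 \<notin> D" by (auto simp: D_def)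
  \<comment> \<open>On the spiral of \<open>x\<close> the values of \<open>f\<close> carry no
    information, whereas \<open>g\<close> is holomorphic there by disjointness.\<close>
  define h where "h z = (if z \<in> qspiral q x then g z else f z)" for z
  have hg: "h z = g z" if "z \<in> D" "z \<notin> qspiral q y" for z
    using that d \<rho> by (auto simp: h_def D_def)
  have hf: "h z = f z" if "z \<notin> qspiral q x" for z
    using that by (auto simp: h_def)
  have "h holomorphic_on (D - qspiral q x)"
    by (rule holomorphic_transform[OF holomorphic_on_subset[OF R1(2)]])
      (use \<rho> hf in \<open>auto simp: D_def\<close>)
  moreover have "h holomorphic_on (D - qspiral q y)"
    by (rule holomorphic_transform[OF holomorphic_on_subset[OF R2(2)]])
      (use \<rho> hg in \<open>auto simp: D_def\<close>)
  \<comment> \<open>Both pieces are open, so holomorphy on each gives holomorphy on the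
    union.\<close>
  ultimately have "h holomorphic_on ((D - qspiral q x) \<union> (D - qspiral q y))"
    by (intro holomorphic_on_Un open_minus_qspiral q xy D)
  moreover have "(D - qspiral q x) \<union> (D - qspiral q y) = D" using disj by auto
  ultimately have hol: "h holomorphic_on ball 0 \<rho> - {0}" by (simp add: D_def)
  obtain \<delta> where \<delta>: "\<delta> > 0" "\<And>z. qdist q x z > \<delta> \<or> qdist q y z > \<delta>"
    using qspiral_separated[OF q xy(1,2)] xy(3) qspiral_eqI[OF q0] by metis
  obtain B1 where B1: "\<And>z. 0 < cmod z \<Longrightarrow> cmod z < \<rho> \<Longrightarrow> qdist q x z > \<delta> \<Longrightarrow> cmod (f z) \<le> B1"
    using bf[OF \<delta>(1) \<rho>(1,3)] by (auto simp: bounded_iff)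
  obtain B2 where B2: "\<And>z. 0 < cmod z \<Longrightarrow> cmod z < \<rho> \<Longrightarrow> qdist q y z > \<delta> \<Longrightarrow> cmod (g z) \<le> B2"
    using bg[OF \<delta>(1) \<rho>(1,4)] by (auto simp: bounded_iff)
  have "cmod (h z) \<le> max B1 B2" if z: "z \<in> D" for z
  proof (cases "qdist q x z > \<delta>")
    case True
    then have "h z = f z" using qdist_pos_imp_not_mem[of q x z] q0 xy \<delta> by (intro hf) auto
    then show ?thesis using B1[of z] True z by (auto simp: D_def)
  next
    case False
    then have "qdist q y z > \<delta>" using \<delta>(2)[of z] by simp
    moreover from this have "h z = g z"
      using qdist_pos_imp_not_mem[of q y z] q0 xy \<delta> z by (intro hg) auto
    ultimately show ?thesis using B2[of z] z by (auto simp: D_def)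
  qed
  then have "\<forall>\<^sub>F z in at 0. cmod (h z) \<le> max B1 B2"
    using \<rho>(1) by (auto simp: eventually_at D_def dist_norm)
  then obtain H where H: "H holomorphic_on ball 0 \<rho>" "\<And>z. z \<in> ball 0 \<rho> - {0} \<Longrightarrow> H z = h z"
    using holomorphic_on_extend_bounded[OF hol] \<rho>(1) by auto
  show ?thesis
  proof
    show "H analytic_on {0}" using H(1) \<rho>(1) by (auto simp: analytic_at intro!: exI[of _ "ball 0 \<rho>"])
    show "\<forall>\<^sub>F z in at 0. (z \<notin> qspiral q x \<longrightarrow> f z = H z) \<and> (z \<notin> qspiral q y \<longrightarrow> g z = H z)"
      using \<rho>(1) H(2) hf hg by (auto simp: eventually_at D_def dist_norm intro!: exI[of _ \<rho>])
  qed
qed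

section \<open>Block matrices\<close>

lemma total_size_Suc: "total_size (Suc k) r = total_size k r + r (Suc k)"
  by (simp add: total_size_def)

lemma block_offset_Suc: "block_offset r (Suc k) = total_size k r"
  by (simp add: total_size_def block_offset_def atLeastLessThanSuc_atLeastAtMost)

lemma block_offset_add_le:
  assumes "i \<in> {1..k}"
  shows "block_offset r i + r i \<le> total_size k r"
proof -
  have "block_offset r i + r i = (\<Sum>l\<in>{1..i}. r l)"
    using assms by (cases i) (auto simp: block_offset_def atLeastLessThanSuc_atLeastAtMost)
  also have "\<dots> \<le> total_size k r"
    unfolding total_size_def using assms by (intro sum_mono2) auto
  finally show ?thesis .
qed

lemma block_index_less:
  assumes "i \<in> {1..k}" "a < r i"
  shows "block_offset r i + a < total_size k r"
  using block_offset_add_le[OF assms(1), of r] assms(2) by linarith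

lemma block_offset_less:
  assumes "1 \<le> i" "i < j" "a < r i"
  shows "block_offset r i + a < block_offset r j"
  using block_index_less[of i "j - 1" a r] assms block_offset_Suc[of r "j - 1"] by simp

lemma block_index_exhaust:
  assumes "p < total_size k r"
  obtains i a where "i \<in> {1..k}" "a < r i" "p = block_offset r i + a"
  using assms
proof (induction k arbitrary: thesis)
  case 0
  then show ?case by (simp add: total_size_def)
next
  case (Suc k)
  show ?case
  proof (cases "p < total_size k r")
    case True
    then show ?thesis using Suc.IH Suc.prems(1) by (metis atLeastAtMost_iff le_SucI)
  next
    case False
    then show ?thesis
      using Suc.prems(2) by (intro Suc.prems(1)[of "Suc k" "p - total_size k r"])
        (auto simp: total_size_Suc block_offset_Suc)
  qed
qed

lemma sum_total_size:
  fixes f :: "nat \<Rightarrow> 'a :: comm_monoid_add"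
  shows "(\<Sum>p<total_size k r. f p) = (\<Sum>l\<in>{1..k}. \<Sum>c<r l. f (block_offset r l + c))"
proof (induction k)
  case 0
  then show ?case by (simp add: total_size_def)
next
  case (Suc k)
  have "(\<Sum>p<m + n. f p) = (\<Sum>p<m. f p) + (\<Sum>c<n. f (m + c))" for m n :: nat
    by (induction n) (simp_all add: add.assoc)
  then show ?case by (simp add: total_size_Suc Suc block_offset_Suc)
qed

lemma mult_mat_blocks:
  fixes X Y :: "'a :: semiring_0 mat"
  assumes "X \<in> carrier_mat (total_size k r) (total_size k r)" "Y \<in> carrier_mat (total_size k r) (total_size k r)"
    and "p < total_size k r" "s < total_size k r"
  shows "(X * Y) $$ (p, s) =
    (\<Sum>l\<in>{1..k}. \<Sum>c<r l. X $$ (p, block_offset r l + c) * Y $$ (block_offset r l + c, s))"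
proof -
  have "(X * Y) $$ (p, s) = (\<Sum>u<total_size k r. X $$ (p, u) * Y $$ (u, s))"
    using assms by (auto simp: scalar_prod_def lessThan_atLeast0 intro!: sum.cong)
  then show ?thesis by (simp add: sum_total_size)
qed

lemma index_block: "a < r i \<Longrightarrow> b < r j \<Longrightarrow> block r i j M $$ (a, b) = M $$ (block_offset r i + a, block_offset r j + b)"
  by (simp add: block_def)

lemma diag_system_Suc:
  "diag_system (Suc k) mu Ad z = (let B = diag_system k mu Ad z; D = (z powi mu (Suc k)) \<cdot>\<^sub>m Ad (Suc k)
     in four_block_mat B (0\<^sub>m (dim_row B) (dim_col D)) (0\<^sub>m (dim_row D) (dim_col B)) D)"
  by (simp add: diag_system_def diag_block_mat_last Let_def del: upt_Suc add: upt_Suc_append)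

lemma diag_system_carrier:
  assumes "\<And>i. i \<in> {1..k} \<Longrightarrow> Ad i \<in> carrier_mat (r i) (r i)"
  shows "diag_system k mu Ad z \<in> carrier_mat (total_size k r) (total_size k r)"
  using assms
proof (induction k)
  case 0
  then show ?case by (simp add: diag_system_def total_size_def)
next
  case (Suc k)
  have 1: "diag_system k mu Ad z \<in> carrier_mat (total_size k r) (total_size k r)"
    using Suc by auto
  have 2: "Ad (Suc k) \<in> carrier_mat (r (Suc k)) (r (Suc k))" using Suc.prems by auto
  show ?case using 1 2 by (auto simp: diag_system_Suc Let_def total_size_Suc)
qed

lemma index_diag_system:
  assumes "\<And>i. i \<in> {1..k} \<Longrightarrow> Ad i \<in> carrier_mat (r i) (r i)"
    and "i \<in> {1..k}" "j \<in> {1..k}" "a < r i" "b < r j"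
  shows "diag_system k mu Ad z $$ (block_offset r i + a, block_offset r j + b) =
    (if i = j then z powi mu i * Ad i $$ (a, b) else 0)"
  using assms
proof (induction k)
  case (Suc k)
  have B: "diag_system k mu Ad z \<in> carrier_mat (total_size k r) (total_size k r)"
    using Suc.prems(1) by (intro diag_system_carrier) auto
  have D: "Ad (Suc k) \<in> carrier_mat (r (Suc k)) (r (Suc k))" using Suc.prems by auto
  have less: "block_offset r i + a < total_size k r" if "i \<in> {1..Suc k}" "i \<noteq> Suc k" "a < r i" for i a
    using that by (intro block_index_less) auto
  show ?case
  proof (cases "i = Suc k"; cases "j = Suc k")
    assume "i \<noteq> Suc k" "j \<noteq> Suc k"
    then show ?thesis
      using Suc.IH Suc.prems B carrier_matD[OF D] less[of i a] less[of j b] by (auto simp: diag_system_Suc Let_def)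
  next
    assume "i = Suc k" "j \<noteq> Suc k"
    then show ?thesis
      using Suc.prems(2-5) carrier_matD[OF B] carrier_matD[OF D] less[of j b] by (auto simp: diag_system_Suc Let_def block_offset_Suc)
  next
    assume "i \<noteq> Suc k" "j = Suc k"
    then show ?thesis
      using Suc.prems(2-5) carrier_matD[OF B] carrier_matD[OF D] less[of i a] by (auto simp: diag_system_Suc Let_def block_offset_Suc)
  next
    assume "i = Suc k" "j = Suc k"
    then show ?thesis
      using Suc.prems(2-5) carrier_matD[OF B] carrier_matD[OF D] by (auto simp: diag_system_Suc Let_def block_offset_Suc)
  qed
qed simp

text \<open>Identity diagonal blocks and zero lower blocks make the matrix upper triangular with
  unit diagonal, entry by entry. Its determinant is 1, so \<open>mat_inverse\<close> does return a
  matrix.\<close>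

lemma mat_inverse_blocks_unitriangular:
  assumes M: "M \<in> carrier_mat (total_size k r) (total_size k r)"
    and diag: "\<forall>i\<in>{1..k}. block r i i M = 1\<^sub>m (r i)"
    and lower: "\<forall>i\<in>{1..k}. \<forall>j\<in>{1..k}. j < i \<longrightarrow> block r i j M = 0\<^sub>m (r i) (r j)"
  obtains B where "mat_inverse M = Some B" "M * B = 1\<^sub>m (total_size k r)" "B * M = 1\<^sub>m (total_size k r)"
    "B \<in> carrier_mat (total_size k r) (total_size k r)"
proof -
  \<comment> \<open>For \<open>p \<le> s\<close> the block row is at least the block column, so the
    entry lies in a diagonal or a lower block.\<close>
  have entry: "M $$ (s, p) = (if s = p then 1 else 0)" if ps: "p \<le> s" "s < total_size k r" for p s
  proof -
    obtain i a where i: "i \<in> {1..k}" "a < r i" "s = block_offset r i + a"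
      using block_index_exhaust ps(2) by metis
    obtain j b where j: "j \<in> {1..k}" "b < r j" "p = block_offset r j + b"
      using block_index_exhaust le_less_trans[OF ps] by metis
    have "j \<le> i"
      using block_offset_less[of i j a r] i j ps(1) by (cases "i < j") auto
    then have "block r i j M $$ (a, b) = (if s = p then 1 else 0)"
      using diag lower i j block_offset_less[of j i b r] by (cases "i = j") auto
    then show ?thesis using i j by (simp add: index_block)
  qed
  then have "upper_triangular M" using M by (auto simp: upper_triangular_def)
  moreover have "diag_mat M = replicate (total_size k r) 1"
    using M entry by (auto simp: diag_mat_def intro!: nth_equalityI)
  ultimately have "det M = 1" using det_upper_triangular M by fastforce
  then have "M \<in> Units (ring_mat TYPE(complex) (total_size k r) ())"
    by (intro det_non_zero_imp_unit M) simp
  then obtain B where "mat_inverse M = Some B"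
    using mat_inverse(1)[OF M, where b = "()"] by (cases "mat_inverse M") auto
  with mat_inverse(2)[OF M this] that show ?thesis by blast
qed

text \<open>Factoring out the lowest power turns the normal form condition into the degree bound
  that makes the inhomogeneous term invisible in the coefficient recursion.\<close>

lemma laurent_K_as_poly:
  assumes "f \<in> laurent_K m n" "m < n"
  obtains p where "degree p < nat (n - m)" "\<And>z. z \<noteq> 0 \<Longrightarrow> f z = z powi m * poly p z"
proof -
  obtain c where c: "\<And>z. z \<noteq> 0 \<Longrightarrow> f z = (\<Sum>l\<in>{m..n - 1}. c l * z powi l)"
    using assms by (auto simp: laurent_K_def)
  define p where "p = (\<Sum>l<nat (n - m). monom (c (m + int l)) l)"
  have "degree p < nat (n - m)"
    unfolding p_def using assms(2)
    by (intro degree_sum_less) (auto intro: le_less_trans[OF degree_monom_le])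
  moreover have "f z = z powi m * poly p z" if "z \<noteq> 0" for z
  proof -
    have "f z = (\<Sum>l<nat (n - m). c (m + int l) * z powi (m + int l))"
      unfolding c[OF that]
      by (rule sum.reindex_bij_witness[of _ "\<lambda>l. m + int l" "\<lambda>l. nat (l - m)"]) auto
    then show ?thesis
      using that by (simp add: p_def poly_sum poly_monom power_int_add sum_distrib_left mult_ac)
  qed
  ultimately show ?thesis using that by blast
qed

text \<open>With 0 as the extension \<open>G\<close>, all estimates are trivial. This admits the
  identity matrix as a summation, since its off-diagonal blocks vanish.\<close>

lemma zero_mem_germs_O: "(\<lambda>_. 0) \<in> germs_O q lam ds"
proof -
  have deriv0: "(deriv ^^ j) (\<lambda>_::complex. 0::complex) = (\<lambda>_. 0)" for j
    by (induction j) auto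
  have qe: "qe q z \<ge> 0" for z
    unfolding qe_def by (intro infsum_nonneg mult_nonneg_nonneg zero_le_power_int) auto
  show ?thesis
    unfolding germs_O_def mem_Collect_eq
    by (intro exI[of _ 1] exI[of _ "\<lambda>_. 0"] conjI allI impI)
      (auto simp: deriv0 qe image_constant_conv intro!: bounded_subset[of "{0}"] exI[of _ 1])
qed

section \<open>The Stokes phenomenon\<close>

lemma countable_power_preimage:
  fixes S :: "complex set"
  assumes "n > 0" "countable S"
  shows "countable {x. x ^ n \<in> S}"
proof -
  have "{x. x ^ n \<in> S} = (\<Union>s\<in>S. {x. x ^ n = s})" by auto
  then show ?thesis using assms by (simp add: countable_finite finite_nth_roots)
qed

lemma countable_qspiral: "countable (qspiral q x)"
proof -
  have "qspiral q x = range (\<lambda>n. x * q powi n)" by (auto simp: qspiral_def)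
  then show ?thesis by simp
qed

lemma finite_eigenvalues:
  fixes A :: "complex mat"
  assumes "A \<in> carrier_mat n n"
  shows "finite {\<alpha>. eigenvalue A \<alpha>}"
proof -
  have "char_poly A \<noteq> 0" using degree_monic_char_poly[OF assms] by auto
  then show ?thesis using poly_roots_finite by (simp add: eigenvalue_root_char_poly[OF assms])
qed

text \<open>Each matrix has finitely many eigenvalues, spirals are countable and a positive power
  has finite fibres. So only countably many parameters are not generic or lie on the given spiral,
  while the complex plane is uncountable.\<close>

lemma generic_other_spiral:
  assumes mu: "strict_mono_on {1..k} mu"
    and Ad: "\<And>i. i \<in> {1..k} \<Longrightarrow> Ad i \<in> carrier_mat (r i) (r i)"
  obtains lam where "lam \<in> generic_set q k mu Ad" "lam \<notin> qspiral q lam0"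
proof -
  define bad where "bad i = {lam. \<exists>j \<alpha> \<beta>. i < j \<and> j \<le> k \<and> eigenvalue (Ad i) \<alpha> \<and> eigenvalue (Ad j) \<beta> \<and>
    (- lam) powi (mu (Suc i) - mu i) \<in> qspiral q (\<alpha> / \<beta>)}" for i
  have "countable (bad i)" if i: "i \<in> {1..k}" for i
  \<comment> \<open>For \<open>i = k\<close> there is no \<open>j\<close> left and nothing is
    excluded; for \<open>i < k\<close> monotonicity makes the exponent positive.\<close>
  proof (cases "i < k")
    case False
    then have "bad i = {}" by (auto simp: bad_def)
    then show ?thesis by simp
  next
    case True
    define n where "n = nat (mu (Suc i) - mu i)"
    have "mu i < mu (Suc i)" using i True by (intro strict_mono_onD[OF mu]) auto
    then have n: "n > 0" "mu (Suc i) - mu i = int n" by (auto simp: n_def)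
    define S where "S = (\<Union>j\<in>{1..k}. \<Union>\<alpha>\<in>{\<alpha>. eigenvalue (Ad i) \<alpha>}. \<Union>\<beta>\<in>{\<beta>. eigenvalue (Ad j) \<beta>}. qspiral q (\<alpha> / \<beta>))"
    have "countable S"
      unfolding S_def using i
      by (intro countable_UN countable_qspiral countable_finite finite_eigenvalues[OF Ad]) auto
    then have "countable (uminus ` {x. x ^ n \<in> S})"
      using n by (intro countable_image countable_power_preimage)
    moreover have "bad i \<subseteq> uminus ` {x. x ^ n \<in> S}"
    proof
      fix lam assume "lam \<in> bad i"
      then have "(- lam) ^ n \<in> S" using i by (force simp: bad_def S_def n)
      then show "lam \<in> uminus ` {x. x ^ n \<in> S}" by (intro image_eqI[of _ _ "- lam"]) auto
    qed
    ultimately show ?thesis by (rule countable_subset[rotated])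
  qed
  then have "countable ({0} \<union> qspiral q lam0 \<union> (\<Union>i\<in>{1..k}. bad i))"
    by (intro countable_Un countable_UN countable_qspiral) auto
  then obtain lam where "lam \<notin> {0} \<union> qspiral q lam0 \<union> (\<Union>i\<in>{1..k}. bad i)"
    using uncountable_UNIV_complex by (metis UNIV_I countable_subset subsetI)
  moreover from this have "lam \<in> generic_set q k mu Ad"
    unfolding generic_set_def bad_def by fastforce
  ultimately show ?thesis using that by blast
qed

text \<open>For the diagonal system the constant identity matrix is a summation along every spiral,
  so the Stokes matrix is the identity times its own inverse.\<close>

lemma diag_system_is_stokes_one:
  assumes Ad: "\<And>i. i \<in> {1..k} \<Longrightarrow> Ad i \<in> carrier_mat (r i) (r i)"
    and A: "\<And>z. z \<noteq> 0 \<Longrightarrow> A z = diag_system k mu Ad z"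
  shows "is_stokes q k r mu Ad lam0 lam A (\<lambda>_. 1\<^sub>m (total_size k r))"
proof -
  let ?I = "1\<^sub>m (total_size k r) :: complex mat"
  have carr: "diag_system k mu Ad z \<in> carrier_mat (total_size k r) (total_size k r)" for z
    by (intro diag_system_carrier Ad)
  have diag: "block r i i ?I = 1\<^sub>m (r i)" if "i \<in> {1..k}" for i
    using block_index_less[OF that, of _ r] by (intro eq_matI) (auto simp: block_def)
  have off_diag: "block r i j ?I = 0\<^sub>m (r i) (r j)" if "i \<in> {1..k}" "j \<in> {1..k}" "i \<noteq> j" for i j
  proof (intro eq_matI)
    fix a b assume "a < dim_row (0\<^sub>m (r i) (r j) :: complex mat)" "b < dim_col (0\<^sub>m (r i) (r j) :: complex mat)"
    then have ab: "a < r i" "b < r j" by auto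
    then have "block_offset r i + a \<noteq> block_offset r j + b"
      using block_offset_less[of i j a r] block_offset_less[of j i b r] that by (cases i j rule: linorder_cases) auto
    then show "block r i j ?I $$ (a, b) = 0\<^sub>m (r i) (r j) $$ (a, b)"
      using that ab block_index_less[of i k a r] block_index_less[of j k b r] by (simp add: block_def)
  qed (auto simp: block_def)
  have summation: "is_summation q k r mu Ad A lam (\<lambda>_. ?I)" for lam
    unfolding is_summation_def
  proof (intro conjI ballI allI impI)
    have "\<forall>\<^sub>F z in at 0 within - qspiral q lam. z \<noteq> 0"
      by (auto simp: eventually_at_filter)
    then show "\<forall>\<^sub>F z in at 0 within - qspiral q lam. ?I \<in> carrier_mat (total_size k r) (total_size k r) \<and>
        (\<forall>i\<in>{1..k}. block r i i ?I = 1\<^sub>m (r i)) \<and>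
        (\<forall>i\<in>{1..k}. \<forall>j\<in>{1..k}. j < i \<longrightarrow> block r i j ?I = 0\<^sub>m (r i) (r j)) \<and>
        ?I * diag_system k mu Ad z = A z * ?I"
    proof eventually_elim
      case (elim z)
      then show ?case
        using diag off_diag left_mult_one_mat[OF carr] right_mult_one_mat[OF carr] by (auto simp: A)
    qed
    fix i j a b assume "i \<in> {1..k}" "j \<in> {1..k}" "i < j" "a < r i" "b < r j"
    then have "(\<lambda>z::complex. block r i j ?I $$ (a, b)) = (\<lambda>_. 0)"
      using off_diag by auto
    then show "(\<lambda>z. block r i j ?I $$ (a, b)) \<in> germs_O q lam (slope_gaps mu i j)"
      using zero_mem_germs_O by simp
  qed
  obtain B where B: "mat_inverse ?I = Some B" "B * ?I = ?I"
    using mat_inverse_blocks_unitriangular[of ?I k r] diag off_diag by (metis less_irrefl one_carrier_mat)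
  show ?thesis
    unfolding is_stokes_def
    by (intro exI[of _ "\<lambda>_. ?I"] conjI summation) (simp add: B)
qed

section \<open>From a trivial Stokes matrix to the diagonal system\<close>

text \<open>The constant entries (\<open>j \<le> i\<close>) are included so that the functional equation can be read off
  entry by entry.\<close>
lemma equal_summations_converge:
  assumes q: "cmod q > 1" and nz: "lam0 \<noteq> 0" "lam \<noteq> 0" "qspiral q lam0 \<noteq> qspiral q lam"
    and F0: "is_summation q k r mu Ad A lam0 F0" and F: "is_summation q k r mu Ad A lam F"
    and eq: "\<forall>\<^sub>F z in at 0 within - (qspiral q lam0 \<union> qspiral q lam). F0 z = F z"
    and ij: "i \<in> {1..k}" "j \<in> {1..k}" and ab: "a < r i" "b < r j"
  obtains h where "h analytic_on {0}" "i = j \<Longrightarrow> h = (\<lambda>_. if a = b then 1 else 0)" "j < i \<Longrightarrow> h = (\<lambda>_. 0)"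
    "\<forall>\<^sub>F z in at 0. (z \<notin> qspiral q lam0 \<longrightarrow> F0 z $$ (block_offset r i + a, block_offset r j + b) = h z) \<and>
      (z \<notin> qspiral q lam \<longrightarrow> F z $$ (block_offset r i + a, block_offset r j + b) = h z)"
proof (cases "i < j")
  case True
  have "(\<lambda>z. block r i j (F0 z) $$ (a, b)) \<in> germs_O q lam0 (slope_gaps mu i j)"
    "(\<lambda>z. block r i j (F z) $$ (a, b)) \<in> germs_O q lam (slope_gaps mu i j)"
    using F0 F ij ab True unfolding is_summation_def by blast+
  moreover have "\<forall>\<^sub>F z in at 0 within - (qspiral q lam0 \<union> qspiral q lam).
      block r i j (F0 z) $$ (a, b) = block r i j (F z) $$ (a, b)"
    using eq by eventually_elim simp
  ultimately obtain h where "h analytic_on {0}"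
    "\<forall>\<^sub>F z in at 0. (z \<notin> qspiral q lam0 \<longrightarrow> block r i j (F0 z) $$ (a, b) = h z) \<and>
      (z \<notin> qspiral q lam \<longrightarrow> block r i j (F z) $$ (a, b) = h z)"
    by (rule germs_O_glue[OF q nz])
  with True ab that show ?thesis by (simp add: index_block)
next
  case False
  \<comment> \<open>On and below the block diagonal both summations have the same prescribed
    constant entry, and that constant is the required function.\<close>
  define c :: complex where "c = (if i = j \<and> a = b then 1 else 0)"
  have entry: "\<forall>\<^sub>F z in at 0. z \<notin> qspiral q x \<longrightarrow> G z $$ (block_offset r i + a, block_offset r j + b) = c"
    if G: "is_summation q k r mu Ad A x G" for x G
  proof -
    have "\<forall>\<^sub>F z in at 0 within - qspiral q x. G z $$ (block_offset r i + a, block_offset r j + b) = c"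
      using conjunct1[OF G[unfolded is_summation_def]]
    proof eventually_elim
      case (elim z)
      then have "block r i j (G z) $$ (a, b) = c"
        using False ij ab by (cases "i = j") (auto simp: c_def)
      then show ?case using ab by (simp add: index_block)
    qed
    then show ?thesis by (auto simp: eventually_at_filter elim: eventually_mono)
  qed
  show ?thesis
  proof (rule that[of "\<lambda>_. c"])
    show "\<forall>\<^sub>F z in at 0. (z \<notin> qspiral q lam0 \<longrightarrow> F0 z $$ (block_offset r i + a, block_offset r j + b) = c) \<and>
      (z \<notin> qspiral q lam \<longrightarrow> F z $$ (block_offset r i + a, block_offset r j + b) = c)"
      using entry[OF F0] entry[OF F] by eventually_elim simp
  qed (use False in \<open>auto simp: c_def\<close>)
qed

text \<open>Fix a block row i and let the block column j increase. Once the blocks of A strictly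
  between are known to vanish, block (i, j) of the functional equation reads z^(mu j) F(qz) A_j =
  z^(mu i) A_i F(z) + U(z), where F is the (i, j) block of \<open>h\<close> and U that of A.
  Dividing by z^(mu i) leaves an equation with shift d = mu j - mu i > 0 and a polynomial of degree
  below d, so U = 0.\<close>

lemma convergent_solution_trivial:
  fixes h :: "nat \<Rightarrow> nat \<Rightarrow> nat \<Rightarrow> nat \<Rightarrow> complex \<Rightarrow> complex"
  assumes q: "cmod q > 1"
    and mu: "strict_mono_on {1..k} mu"
    and Ad: "\<And>i. i \<in> {1..k} \<Longrightarrow> Ad i \<in> carrier_mat (r i) (r i) \<and> invertible_mat (Ad i)"
    and A: "A \<in> normal_forms k r mu Ad"
    and h: "\<And>i j a b. i \<in> {1..k} \<Longrightarrow> j \<in> {1..k} \<Longrightarrow> a < r i \<Longrightarrow> b < r j \<Longrightarrow> h i j a b analytic_on {0}"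
    and h_diag: "\<And>i a b. i \<in> {1..k} \<Longrightarrow> a < r i \<Longrightarrow> b < r i \<Longrightarrow> h i i a b = (\<lambda>_. if a = b then 1 else 0)"
    and h_lower: "\<And>i j a b. i \<in> {1..k} \<Longrightarrow> j \<in> {1..k} \<Longrightarrow> j < i \<Longrightarrow> a < r i \<Longrightarrow> b < r j \<Longrightarrow> h i j a b = (\<lambda>_. 0)"
    and eq: "\<And>i j a b. i \<in> {1..k} \<Longrightarrow> j \<in> {1..k} \<Longrightarrow> a < r i \<Longrightarrow> b < r j \<Longrightarrow> \<forall>\<^sub>F z in at 0.
      (\<Sum>l\<in>{1..k}. \<Sum>c<r l. h i l a c (q * z) * diag_system k mu Ad z $$ (block_offset r l + c, block_offset r j + b)) =
      (\<Sum>l\<in>{1..k}. \<Sum>c<r l. A z $$ (block_offset r i + a, block_offset r l + c) * h l j c b z)"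
    and z: "z \<noteq> 0"
  shows "A z = diag_system k mu Ad z"
proof -
  have Ad': "\<And>i. i \<in> {1..k} \<Longrightarrow> Ad i \<in> carrier_mat (r i) (r i)" using Ad by blast
  have carr: "diag_system k mu Ad z \<in> carrier_mat (total_size k r) (total_size k r)" for z
    by (intro diag_system_carrier Ad')
  have entry: "diag_system k mu Ad z $$ (block_offset r i + a, block_offset r j + b) =
      (if i = j then z powi mu i * Ad i $$ (a, b) else 0)"
    if "i \<in> {1..k}" "j \<in> {1..k}" "a < r i" "b < r j" for i j a b z
    using that by (intro index_diag_system Ad') auto
  have upper: "\<forall>a<r i. \<forall>b<r j. \<forall>z. z \<noteq> 0 \<longrightarrow> A z $$ (block_offset r i + a, block_offset r j + b) = 0"
    if i: "i \<in> {1..k}" and ij: "i < j" and "j \<le> k" for i j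
    using that(2,3)
  proof (induction j rule: less_induct)
    case (less j)
    then have j: "j \<in> {1..k}" using i by auto
    define d where "d = nat (mu j - mu i)"
    have "mu i < mu j" using i j less.prems by (intro strict_mono_onD[OF mu]) auto
    then have d: "d > 0" "mu j = mu i + int d" by (auto simp: d_def)
    have "\<exists>p. degree p < d \<and> (\<forall>z. z \<noteq> 0 \<longrightarrow>
        A z $$ (block_offset r i + a, block_offset r j + b) = z powi mu i * poly p z)"
      if ab: "a < r i" "b < r j" for a b
    proof -
      have "(\<lambda>z. block r i j (A z) $$ (a, b)) \<in> laurent_K (mu i) (mu j)"
        using A i j less.prems ab unfolding normal_forms_def by blast
      then obtain p where "degree p < nat (mu j - mu i)"
        "\<And>z. z \<noteq> 0 \<Longrightarrow> block r i j (A z) $$ (a, b) = z powi mu i * poly p z"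
        by (rule laurent_K_as_poly[OF _ \<open>mu i < mu j\<close>]) blast
      then show ?thesis using ab by (intro exI[of _ p]) (simp add: index_block d_def)
    qed
    then obtain p where deg: "\<And>a b. a < r i \<Longrightarrow> b < r j \<Longrightarrow> degree (p a b) < d"
      and p: "\<And>a b z. a < r i \<Longrightarrow> b < r j \<Longrightarrow> z \<noteq> 0 \<Longrightarrow>
        A z $$ (block_offset r i + a, block_offset r j + b) = z powi mu i * poly (p a b) z"
      by metis
    have "p a b = 0" if ab: "a < r i" "b < r j" for a b
    proof (rule q_sylvester_system_trivial[OF q d(1), where N = "Ad j" and n = "r j" and m = "r i"
          and f = "h i j" and M = "Ad i"])
      show "Ad j \<in> carrier_mat (r j) (r j)" "invertible_mat (Ad j)" using Ad j by auto
      show "h i j a b has_fps_expansion fps_expansion (h i j a b) 0" if "a < r i" "b < r j" for a b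
        using h[OF i j that] by (rule analytic_at_imp_has_fps_expansion_0)
      show "a < r i" "b < r j" by fact+
      fix a b assume ab: "a < r i" "b < r j"
      show "degree (p a b) < d" by (rule deg[OF ab])
      have "\<forall>\<^sub>F z in at 0. z \<noteq> (0::complex)" by (auto simp: eventually_at_filter)
      with eq[OF i j ab]
      show "\<forall>\<^sub>F z in at 0. z ^ d * (\<Sum>c<r j. h i j a c (q * z) * Ad j $$ (c, b)) =
          (\<Sum>c<r i. Ad i $$ (a, c) * h i j c b z) + poly (p a b) z"
      proof eventually_elim
        case (elim z)
        define R where "R l = (\<Sum>c<r l. A z $$ (block_offset r i + a, block_offset r l + c) * h l j c b z)" for l
        have "(\<Sum>c<r l. h i l a c (q * z) * diag_system k mu Ad z $$ (block_offset r l + c, block_offset r j + b)) =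
          (if l = j then z powi mu j * (\<Sum>c<r j. h i j a c (q * z) * Ad j $$ (c, b)) else 0)" if "l \<in> {1..k}" for l
          using that j ab by (auto simp: entry sum_distrib_left mult_ac)
        then have lhs: "(\<Sum>l\<in>{1..k}. \<Sum>c<r l. h i l a c (q * z) * diag_system k mu Ad z $$ (block_offset r l + c, block_offset r j + b)) =
            z powi mu j * (\<Sum>c<r j. h i j a c (q * z) * Ad j $$ (c, b))"
          using j by simp
        \<comment> \<open>Left of \<open>i\<close> the block of A is zero by triangularity, between
          \<open>i\<close> and \<open>j\<close> by induction; beyond \<open>j\<close> the block of
          \<open>h\<close> is zero.\<close>
        have "R l = 0" if l: "l \<in> {1..k}" "l \<noteq> i" "l \<noteq> j" for l
        proof -
          consider "l < i" | "i < l" "l < j" | "j < l" using l by linarith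
          then show ?thesis
          proof cases
            case 1
            then have "block r i l (A z) = 0\<^sub>m (r i) (r l)"
              using A i l elim unfolding normal_forms_def by auto
            then have "A z $$ (block_offset r i + a, block_offset r l + c) = 0" if "c < r l" for c
              using that ab by (metis index_block index_zero_mat(1))
            then show ?thesis by (simp add: R_def)
          next
            case 2
            then show ?thesis using less.IH[of l] l ab elim by (auto simp: R_def)
          next
            case 3
            then show ?thesis using h_lower[of l j] l j ab by (auto simp: R_def)
          qed
        qed
        then have "(\<Sum>l\<in>{1..k}. R l) = (\<Sum>l\<in>{i, j}. R l)"
          using i j by (intro sum.mono_neutral_right) auto
        also have "\<dots> = R i + R j" using less.prems by simp
        \<comment> \<open>The diagonal block of \<open>h\<close> is the identity, so
          \<open>R j\<close> is the unknown entry of A itself.\<close>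
        also have "R j = (\<Sum>c<r j. if c = b then A z $$ (block_offset r i + a, block_offset r j + c) else 0)"
          unfolding R_def using h_diag[OF j] ab by (intro sum.cong) auto
        also have "\<dots> = z powi mu i * poly (p a b) z"
          using ab p elim by simp
        also have "R i = z powi mu i * (\<Sum>c<r i. Ad i $$ (a, c) * h i j c b z)"
        proof -
          have blk: "block r i i (A z) = (z powi mu i) \<cdot>\<^sub>m Ad i"
            using A i elim unfolding normal_forms_def by auto
          have "A z $$ (block_offset r i + a, block_offset r i + c) = z powi mu i * Ad i $$ (a, c)" if "c < r i" for c
            using index_block[of a r i c i "A z"] that ab Ad'[OF i] by (simp add: blk)
          then show ?thesis by (simp add: R_def sum_distrib_left mult_ac)
        qed
        finally have "z powi mu j * (\<Sum>c<r j. h i j a c (q * z) * Ad j $$ (c, b)) =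
          z powi mu i * ((\<Sum>c<r i. Ad i $$ (a, c) * h i j c b z) + poly (p a b) z)"
          using elim(1) lhs by (simp add: R_def distrib_left)
        then show ?case using elim(2) by (simp add: d power_int_add mult.assoc)
      qed
    qed
    then show ?case using p by simp
  qed
  show ?thesis
  proof (rule eq_matI)
    have "A z \<in> carrier_mat (total_size k r) (total_size k r)"
      using A z by (auto simp: normal_forms_def)
    with carr[of z] show "dim_row (A z) = dim_row (diag_system k mu Ad z)" "dim_col (A z) = dim_col (diag_system k mu Ad z)"
      by auto
    fix s t assume "s < dim_row (diag_system k mu Ad z)" "t < dim_col (diag_system k mu Ad z)"
    then have st: "s < total_size k r" "t < total_size k r" using carr[of z] by auto
    obtain i a where i: "i \<in> {1..k}" "a < r i" "s = block_offset r i + a"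
      using block_index_exhaust[OF st(1)] .
    obtain j b where j: "j \<in> {1..k}" "b < r j" "t = block_offset r j + b"
      using block_index_exhaust[OF st(2)] .
    have "block r i j (A z) $$ (a, b) = (if i = j then z powi mu i * Ad i $$ (a, b) else 0)"
    proof (cases i j rule: linorder_cases)
      case less
      then show ?thesis using upper[OF i(1) less] i j z by (simp add: index_block)
    next
      case equal
      then have "block r i j (A z) = (z powi mu i) \<cdot>\<^sub>m Ad i"
        using A i z unfolding normal_forms_def by auto
      then show ?thesis using equal i j Ad'[OF i(1)] by simp
    next
      case greater
      then have "block r i j (A z) = 0\<^sub>m (r i) (r j)"
        using A i j z unfolding normal_forms_def by auto
      then show ?thesis using greater i j by simp
    qed
    then show "A z $$ (s, t) = diag_system k mu Ad z $$ (s, t)"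
      using i j by (simp add: index_block entry)
  qed
qed

text \<open>A trivial Stokes matrix makes the two summations agree off both spirals, so their
  entries glue to functions analytic at 0. Every z near 0 avoids at least one spiral, together with
  qz, so the functional equation passes to the glued matrix on a full punctured
  neighbourhood.\<close>

lemma stokes_one_imp_diag_system:
  assumes q: "cmod q > 1"
    and mu: "strict_mono_on {1..k} mu"
    and Ad: "\<And>i. i \<in> {1..k} \<Longrightarrow> Ad i \<in> carrier_mat (r i) (r i) \<and> invertible_mat (Ad i)"
    and A: "A \<in> normal_forms k r mu Ad"
    and nz: "lam0 \<noteq> 0" "lam \<noteq> 0" "qspiral q lam0 \<noteq> qspiral q lam"
    and stokes: "is_stokes q k r mu Ad lam0 lam A (\<lambda>_. 1\<^sub>m (total_size k r))"
    and z: "z \<noteq> 0"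
  shows "A z = diag_system k mu Ad z"
proof -
  let ?N = "total_size k r"
  have q0: "q \<noteq> 0" using q by auto
  obtain F0 F where F0: "is_summation q k r mu Ad A lam0 F0" and F: "is_summation q k r mu Ad A lam F"
    and St: "\<forall>\<^sub>F z in at 0 within - (qspiral q lam0 \<union> qspiral q lam). 1\<^sub>m ?N = the (mat_inverse (F0 z)) * F z"
    using stokes unfolding is_stokes_def by blast
  have near: "\<forall>\<^sub>F z in at 0. z \<notin> qspiral q x \<longrightarrow> G z \<in> carrier_mat ?N ?N \<and>
        (\<forall>i\<in>{1..k}. block r i i (G z) = 1\<^sub>m (r i)) \<and>
        (\<forall>i\<in>{1..k}. \<forall>j\<in>{1..k}. j < i \<longrightarrow> block r i j (G z) = 0\<^sub>m (r i) (r j)) \<and>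
        G (q * z) * diag_system k mu Ad z = A z * G z"
    if "is_summation q k r mu Ad A x G" for x G
    using conjunct1[OF that[unfolded is_summation_def]]
    by (auto simp: eventually_at_filter elim: eventually_mono)
  have "\<forall>\<^sub>F z in at 0. z \<in> - (qspiral q lam0 \<union> qspiral q lam) \<longrightarrow> 1\<^sub>m ?N = the (mat_inverse (F0 z)) * F z"
    using St by (auto simp: eventually_at_filter elim: eventually_mono)
  with near[OF F0] near[OF F]
  \<comment> \<open>Multiplying on the left by \<open>F0 z\<close> cancels its inverse.\<close>
  have "\<forall>\<^sub>F z in at 0. z \<in> - (qspiral q lam0 \<union> qspiral q lam) \<longrightarrow> F0 z = F z"
  proof eventually_elim
    case (elim z)
    show ?case
    proof
      assume z: "z \<in> - (qspiral q lam0 \<union> qspiral q lam)"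
      then have F0z: "F0 z \<in> carrier_mat ?N ?N" "F z \<in> carrier_mat ?N ?N"
        and one: "1\<^sub>m ?N = the (mat_inverse (F0 z)) * F z"
        and blocks: "\<forall>i\<in>{1..k}. block r i i (F0 z) = 1\<^sub>m (r i)"
          "\<forall>i\<in>{1..k}. \<forall>j\<in>{1..k}. j < i \<longrightarrow> block r i j (F0 z) = 0\<^sub>m (r i) (r j)"
        using elim by auto
      obtain B where B: "mat_inverse (F0 z) = Some B" "F0 z * B = 1\<^sub>m ?N" "B \<in> carrier_mat ?N ?N"
        using mat_inverse_blocks_unitriangular[OF F0z(1) blocks] by metis
      have "B * F z = 1\<^sub>m ?N" using one B by simp
      then have "F0 z = F0 z * (B * F z)" using F0z by simp
      also have "\<dots> = F0 z * B * F z" using B(3) F0z by (simp add: assoc_mult_mat)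
      also have "\<dots> = F z" using B F0z by simp
      finally show "F0 z = F z" .
    qed
  qed
  then have FF: "\<forall>\<^sub>F z in at 0 within - (qspiral q lam0 \<union> qspiral q lam). F0 z = F z"
    by (auto simp: eventually_at_filter elim: eventually_mono)
  define good where "good i j a b h \<longleftrightarrow> h analytic_on {0} \<and> (i = j \<longrightarrow> h = (\<lambda>_. if a = b then 1 else 0)) \<and>
      (j < i \<longrightarrow> h = (\<lambda>_. 0)) \<and>
      (\<forall>\<^sub>F z in at 0. (z \<notin> qspiral q lam0 \<longrightarrow> F0 z $$ (block_offset r i + a, block_offset r j + b) = h z) \<and>
        (z \<notin> qspiral q lam \<longrightarrow> F z $$ (block_offset r i + a, block_offset r j + b) = h z))"
    for i j a b and h :: "complex \<Rightarrow> complex"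
  \<comment> \<open>One choice for all entries at once. The value is arbitrary when the indices fall
    outside their blocks; it is used only inside them.\<close>
  define h where "h i j a b = (SOME h. good i j a b h)" for i j a b
  have "\<exists>h. good i j a b h" if "i \<in> {1..k}" "j \<in> {1..k}" "a < r i" "b < r j" for i j a b
  proof (rule equal_summations_converge[OF q nz F0 F FF that])
    fix g assume "g analytic_on {0}" "i = j \<Longrightarrow> g = (\<lambda>_. if a = b then 1 else 0)" "j < i \<Longrightarrow> g = (\<lambda>_. 0)"
      "\<forall>\<^sub>F z in at 0. (z \<notin> qspiral q lam0 \<longrightarrow> F0 z $$ (block_offset r i + a, block_offset r j + b) = g z) \<and>
        (z \<notin> qspiral q lam \<longrightarrow> F z $$ (block_offset r i + a, block_offset r j + b) = g z)"
    then have "good i j a b g" unfolding good_def by blast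
    then show "\<exists>h. good i j a b h" by (rule exI[of "good i j a b" g])
  qed
  then have h: "good i j a b (h i j a b)" if "i \<in> {1..k}" "j \<in> {1..k}" "a < r i" "b < r j" for i j a b
    unfolding h_def using that by (intro someI_ex[of "good i j a b"])
  define P where "P z \<longleftrightarrow> (\<forall>i\<in>{1..k}. \<forall>j\<in>{1..k}. \<forall>a\<in>{..<r i}. \<forall>b\<in>{..<r j}.
      (z \<notin> qspiral q lam0 \<longrightarrow> F0 z $$ (block_offset r i + a, block_offset r j + b) = h i j a b z) \<and>
      (z \<notin> qspiral q lam \<longrightarrow> F z $$ (block_offset r i + a, block_offset r j + b) = h i j a b z))" for z
  have P: "\<forall>\<^sub>F z in at 0. P z"
    unfolding P_def using h by (intro eventually_ball_finite ballI) (auto simp: good_def)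
  \<comment> \<open>Whatever holds near 0 also holds at \<open>q * z\<close> for z near 0, which is
    how the left-hand side of the functional equation is reached.\<close>
  have "filterlim (\<lambda>z. q * z) (at 0) (at 0)"
    using q0 by (auto simp: filterlim_at eventually_at_filter intro!: tendsto_eq_intros)
  then have scale: "\<forall>\<^sub>F z in at 0. S (q * z)" if "\<forall>\<^sub>F z in at 0. S z" for S
    using that by (simp add: filterlim_iff)
  show ?thesis
  proof (rule convergent_solution_trivial[OF q mu Ad A _ _ _ _ z, where h = h])
    fix i j a b assume ij: "i \<in> {1..k}" "j \<in> {1..k}" and ab: "a < r i" "b < r j"
    show "\<forall>\<^sub>F z in at 0.
      (\<Sum>l\<in>{1..k}. \<Sum>c<r l. h i l a c (q * z) * diag_system k mu Ad z $$ (block_offset r l + c, block_offset r j + b)) =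
      (\<Sum>l\<in>{1..k}. \<Sum>c<r l. A z $$ (block_offset r i + a, block_offset r l + c) * h l j c b z)"
      using P scale[OF P] near[OF F0] near[OF F] scale[OF near[OF F0]] scale[OF near[OF F]]
        eventually_neq_at_within[of 0 0 UNIV]
    proof eventually_elim
      case (elim z)
      have carr: "A z \<in> carrier_mat ?N ?N" "diag_system k mu Ad z \<in> carrier_mat ?N ?N"
        using A elim(7) diag_system_carrier[of k Ad r mu z] Ad by (auto simp: normal_forms_def)
      have idx: "block_offset r i + a < ?N" "block_offset r j + b < ?N"
        using ij ab by (auto intro: block_index_less)
      have entries: ?case if G: "G z \<in> carrier_mat ?N ?N" "G (q * z) \<in> carrier_mat ?N ?N"
          "G (q * z) * diag_system k mu Ad z = A z * G z"
        and Gh: "\<And>w i j a b. w \<in> {z, q * z} \<Longrightarrow> i \<in> {1..k} \<Longrightarrow> j \<in> {1..k} \<Longrightarrow> a < r i \<Longrightarrow> b < r j \<Longrightarrow>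
          G w $$ (block_offset r i + a, block_offset r j + b) = h i j a b w" for G
      proof -
        have "(G (q * z) * diag_system k mu Ad z) $$ (block_offset r i + a, block_offset r j + b) =
            (A z * G z) $$ (block_offset r i + a, block_offset r j + b)" using G by simp
        then show ?thesis
          unfolding mult_mat_blocks[OF G(2) carr(2) idx] mult_mat_blocks[OF carr(1) G(1) idx]
          using ij ab by (simp add: Gh)
      qed
      show ?case
      \<comment> \<open>Off the spiral of \<open>lam0\<close> the equation is read from
        \<open>F0\<close>; on it, disjointness allows reading it from \<open>F\<close>.\<close>
      proof (cases "z \<in> qspiral q lam0")
        case False
        then have "q * z \<notin> qspiral q lam0" by (simp add: mult_q_mem_qspiral_iff[OF q0])
        with False elim show ?thesis by (intro entries[of F0]) (auto simp: P_def)
      next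
        case True
        then have "z \<notin> qspiral q lam" using qspiral_disjoint[OF q0 nz(3)] by auto
        moreover from this have "q * z \<notin> qspiral q lam" by (simp add: mult_q_mem_qspiral_iff[OF q0])
        ultimately show ?thesis using elim by (intro entries[of F]) (auto simp: P_def)
      qed
    qed
  qed (use h in \<open>auto simp: good_def\<close>)
qed

theorem theorem5p5p7:
  fixes q lam0 :: complex and k :: nat and r :: "nat \<Rightarrow> nat" and mu :: "nat \<Rightarrow> int"
    and Ad :: "nat \<Rightarrow> complex mat" and A :: "complex \<Rightarrow> complex mat"
  assumes q: "cmod q > 1"
    and k: "k \<ge> 1"
    and mu: "strict_mono_on {1..k} mu"
    and Ad: "\<And>i. i \<in> {1..k} \<Longrightarrow> Ad i \<in> carrier_mat (r i) (r i) \<and> invertible_mat (Ad i)"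
    and lam0: "lam0 \<in> generic_set q k mu Ad"
    and A: "A \<in> normal_forms k r mu Ad"
  shows "((\<exists>lam \<in> generic_set q k mu Ad. qspiral q lam \<noteq> qspiral q lam0 \<and>
             is_stokes q k r mu Ad lam0 lam A (\<lambda>_. 1\<^sub>m (total_size k r)))
         \<longleftrightarrow> (\<forall>lam \<in> generic_set q k mu Ad.
             is_stokes q k r mu Ad lam0 lam A (\<lambda>_. 1\<^sub>m (total_size k r))))
     \<and> ((\<forall>lam \<in> generic_set q k mu Ad.
             is_stokes q k r mu Ad lam0 lam A (\<lambda>_. 1\<^sub>m (total_size k r)))
         \<longleftrightarrow> (\<forall>z. z \<noteq> 0 \<longrightarrow> A z = diag_system k mu Ad z))"
    (is "(?one \<longleftrightarrow> ?two) \<and> (?two \<longleftrightarrow> ?three)")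
proof -
  have Ad': "\<And>i. i \<in> {1..k} \<Longrightarrow> Ad i \<in> carrier_mat (r i) (r i)" using Ad by blast
  \<comment> \<open>The implications form the cycle (1) => (3) => (2) => (1).\<close>
  have "?three" if one: "?one"
  proof (intro allI impI)
    obtain lam where lam: "lam \<in> generic_set q k mu Ad" "qspiral q lam \<noteq> qspiral q lam0"
      "is_stokes q k r mu Ad lam0 lam A (\<lambda>_. 1\<^sub>m (total_size k r))" using one by blast
    fix z :: complex assume "z \<noteq> 0"
    then show "A z = diag_system k mu Ad z"
      using lam lam0
      by (intro stokes_one_imp_diag_system[OF q mu Ad A _ _ _ lam(3)]) (auto simp: generic_set_def)
  qed
  moreover have "?two" if "?three"
    using that by (intro ballI diag_system_is_stokes_one Ad') auto
  \<comment> \<open>A statement about all parameters yields a witness for (1) only if some generic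
    parameter lies on another spiral; the countability argument supplies it.\<close>
  moreover have "?one" if two: "?two"
  proof -
    obtain lam where "lam \<in> generic_set q k mu Ad" "lam \<notin> qspiral q lam0"
      by (rule generic_other_spiral[OF mu Ad'])
    with two qspiral_self[of lam q] show ?thesis by (intro bexI[of _ lam]) auto
  qed
  ultimately show ?thesis by blast
qed

end
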